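(* Suppose the plus-connected occupied component $C^+(0)$ containing the origin is finite. Let $\Lambda^+_0$ be the set of all vacant squares that share a corner with some occupied square in $C^+(0)$. Then there exists a unique star connected $S$-cycle $H_{out} = (U_1,\dots,U_q)$ with the following properties: (i) For every $i$, $1 \leq i \leq q$, the square $U_i \in \{S_k\}_{k\ge 0}$ is in $\Lambda^+_0$. (ii) The outermost boundary of $H_{out}$ is a single cycle $\partial_H$. (iii) If $S_k \in C^+(0)\cup \Lambda^+_0$, then either $S_k$ is in $H_{out}$ (i.e. $S_k = U_i$ for some $i$) or $S_k$ is contained in the interior of $\partial_H$.
   Context: Tile $\mathbb{R}^2$ into unit squares $\{S_k\}_{k\ge 0}$ with disjoint interiors (the standard square grid with sides parallel to the axes), the origin being the centre of $S_0$. Two distinct squares are star-adjacent (or simply adjacent) if they share a corner, and plus-adjacent if they share an edge. Every square is assigned one of two states, occupied or vacant (the assignment is arbitrary). The plus-connected occupied component $C^+(0)$ containing the origin: if $S_0$ is vacant, $C^+(0)=\emptyset$; otherwise $C^+(0)$ is the set of all occupied squares $S$ for which there is a sequence of distinct occupied squares starting at $S_0$ and ending at $S$, with consecutive squares plus-adjacent. Star connected $S$-cycle: for a set of squares $\{H_i\}_{1\le i\le n}$ in $\{S_k\}_{k\ge0}$, the sequence $(H_1,\dots,H_n)$ is a star connected $S$-path if $H_i$ is star-adjacent to $H_{i+1}$ for each $1\le i\le n-1$; it is a star connected $S$-cycle if in addition $H_n$ is star-adjacent to $H_1$. Outermost boundary: let $L$ be a finite star- or plus-connected collection of squares (for a sequence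 of squares, take the collection of squares occurring in it; these are regarded as occupied and all other squares as vacant). Let $G_L$ be the graph whose vertices are the corners, and whose edges are the edges, of the squares in $L$. A cycle in $G_L$ is a closed path $(v_0,v_1,\dots,v_m,v_0)$ with $v_0,\dots,v_m$ distinct and consecutive vertices joined by an edge of $G_L$. A cycle divides the plane into a bounded connected region (its interior) and an unbounded connected region (its exterior). An edge $e$ of $G_L$ is an outermost boundary edge if for every cycle $C$ in $G_L$, either $e$ is an edge of $C$ or $e$ belongs to the exterior of $C$. The outermost boundary of $L$ is the set of all outermost boundary edges of $G_L$; saying that it is a single cycle means that it is the edge set of one cycle. A square is contained in the interior (resp. lies in the exterior) of a cycle if its open interior is contained in the bounded (resp. unbounded) region; an edge is in the exterior (resp. interior) if the edge without its endpoints is in the unbounded (resp. bounded) region.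
   Formalization: S_0 is assumed occupied (else no cycle exists). "Unique" is false as stated; instead: every S-cycle with (i)–(iii) has the same outermost boundary, contains all squares of H_out, and if not longer than H_out equals it up to rotation and reversal. *)

theory Defs
  imports "HOL-Analysis.Analysis"
begin

text \<open>
  The plane is \<^typ>\<open>complex\<close>, so that \<^const>\<open>inside\<close> and \<^const>\<open>outside\<close> (the union of the bounded,
  respectively unbounded, components of the complement) apply. The unit squares are indexed by
  their centres, which are the points with integer coordinates; \<open>(0, 0)\<close> is the square centred
  at the origin.
\<close>

type_synonym square = "int \<times> int"

definition square_region :: "square \<Rightarrow> complex set" where
  "square_region s =
     cbox (Complex (of_int (fst s) - 1/2) (of_int (snd s) - 1/2))
          (Complex (of_int (fst s) + 1/2) (of_int (snd s) + 1/2))"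

definition corners :: "square \<Rightarrow> complex set" where
  "corners s = {Complex (of_int (fst s) + a) (of_int (snd s) + b) | a b.
                  a \<in> {- 1/2, 1/2} \<and> b \<in> {- 1/2, 1/2}}"

text \<open>
  An edge is the set of its two endpoints; as a subset of the plane it is the convex hull of this
  set. Two corners of a unit square span an edge iff their distance is 1 (and not \<open>sqrt 2\<close>).
\<close>

definition edges_of :: "square \<Rightarrow> complex set set" where
  "edges_of s = {{u, v} | u v. u \<in> corners s \<and> v \<in> corners s \<and> dist u v = 1}"

definition star_adj :: "square \<Rightarrow> square \<Rightarrow> bool" where
  "star_adj s t \<longleftrightarrow> s \<noteq> t \<and> corners s \<inter> corners t \<noteq> {}"

definition plus_adj :: "square \<Rightarrow> square \<Rightarrow> bool" where
  "plus_adj s t \<longleftrightarrow> s \<noteq> t \<and> edges_of s \<inter> edges_of t \<noteq> {}"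

text \<open>A configuration is given by its set \<open>occ\<close> of occupied squares.\<close>

definition plus_component :: "square set \<Rightarrow> square set" where
  "plus_component occ =
     {s. \<exists>p. p \<noteq> [] \<and> hd p = (0, 0) \<and> last p = s \<and>
             distinct p \<and> set p \<subseteq> occ \<and> successively plus_adj p}"

definition vacant_boundary :: "square set \<Rightarrow> square set" where
  "vacant_boundary occ =
     {s. s \<notin> occ \<and> (\<exists>t \<in> plus_component occ. corners s \<inter> corners t \<noteq> {})}"

definition star_S_path :: "square list \<Rightarrow> bool" where
  "star_S_path H \<longleftrightarrow> H \<noteq> [] \<and> successively star_adj H"

definition star_S_cycle :: "square list \<Rightarrow> bool" where
  "star_S_cycle H \<longleftrightarrow> star_S_path H \<and> star_adj (last H) (hd H)"

definition graph_edges :: "square set \<Rightarrow> complex set set" where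
  "graph_edges L = (\<Union>s\<in>L. edges_of s)"

definition cycle_edges :: "complex list \<Rightarrow> complex set set" where
  "cycle_edges vs = {{vs ! i, vs ! (Suc i mod length vs)} | i. i < length vs}"

text \<open>
  A cycle \<open>(v\<^sub>0, \<dots>, v\<^sub>m, v\<^sub>0)\<close> is given by the list of \<open>v\<^sub>0, \<dots>, v\<^sub>m\<close>. The bound on the length
  excludes walking back and forth along a single edge, which does not divide the plane.
\<close>

definition graph_cycle :: "square set \<Rightarrow> complex list \<Rightarrow> bool" where
  "graph_cycle L vs \<longleftrightarrow> 3 \<le> length vs \<and> distinct vs \<and> cycle_edges vs \<subseteq> graph_edges L"

definition curve :: "complex set set \<Rightarrow> complex set" where
  "curve E = (\<Union>e\<in>E. convex hull e)"

definition outermost_boundary :: "square set \<Rightarrow> complex set set" where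
  "outermost_boundary L =
     {e \<in> graph_edges L. \<forall>vs. graph_cycle L vs \<longrightarrow>
        e \<in> cycle_edges vs \<or> convex hull e - e \<subseteq> outside (curve (cycle_edges vs))}"

definition single_cycle :: "square set \<Rightarrow> complex set set \<Rightarrow> bool" where
  "single_cycle L E \<longleftrightarrow> (\<exists>vs. graph_cycle L vs \<and> cycle_edges vs = E)"

definition surrounding_S_cycle :: "square set \<Rightarrow> square list \<Rightarrow> bool" where
  "surrounding_S_cycle occ H \<longleftrightarrow>
     star_S_cycle H \<and>
     set H \<subseteq> vacant_boundary occ \<and>
     single_cycle (set H) (outermost_boundary (set H)) \<and>
     (\<forall>s \<in> plus_component occ \<union> vacant_boundary occ.
        s \<in> set H \<or> interior (square_region s) \<subseteq> inside (curve (outermost_boundary (set H))))"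

text \<open>
  Uniqueness of a surrounding cycle cannot hold outright, even for the set of its squares: if
  the occupied squares are \<open>(0, 0)\<close>, \<open>(1, 0)\<close> and \<open>(0, 1)\<close>, then the ring of all vacant squares around
  them is such a cycle, and so is the ring without \<open>(1, 1)\<close>, because \<open>(1, 2)\<close> and \<open>(2, 1)\<close> share
  a corner. The outermost boundary is the same for both. What is unique is this boundary, and the
  cycle without superfluous squares: up to the choice of starting square and of
  direction, every other surrounding cycle is longer, and it contains all of its squares.
\<close>

text \<open>Equality of cyclic sequences: up to the choice of starting square and of direction.\<close>

definition same_S_cycle :: "square list \<Rightarrow> square list \<Rightarrow> bool" where
  "same_S_cycle H H' \<longleftrightarrow> (\<exists>k. H' = rotate k H \<or> H' = rotate k (rev H))"

end

theory Submission
  imports Defs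
begin

text \<open>
  Write \<open>C\<close> for the finite component and \<open>L\<close> for the vacant squares that touch it. Every edge
  neighbour of \<open>C\<close> lies in \<open>C \<union> L\<close>. The exterior consists of the squares from which one can escape
  to infinity outside \<open>C \<union> L\<close>, moving across edges; its complement is finite and is \<open>C \<union> L\<close> with
  the holes filled. The edges between the two sides form the boundary, and the square on the
  inner side of a boundary edge always belongs to \<open>L\<close>. These inner squares are the squares of the
  cycle \<open>H\<close>, in the order in which the boundary visits them.

  Almost all the planar topology is replaced by one parity fact (\<open>even_edge_set_potential\<close>): if
  every vertex has even degree in a finite set of grid edges, then there is a two-valued function
  on the squares that jumps exactly across the edges of the set and vanishes far up. It counts,
  modulo 2, the edges of the set above a square.

  \<^item> The boundary is a single cycle (\<open>boundary_is_cycle\<close>). It is even and nonempty, so it contains a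
    cycle. The potential of this cycle is constant on \<open>C \<union> L\<close> and on the exterior and differs
    between them, so every boundary edge already lies on the cycle.

  \<^item> Suppose that two boundary squares \<open>f\<close> and \<open>g\<close>, possibly equal, share a corner. This chord
    splits the boundary into two arcs. Close one of them up inside \<open>f\<close> and \<open>g\<close>, and compare
    potentials: the component \<open>C\<close> is on one side of the chord only, and a boundary square on the
    other side still has to touch \<open>C\<close>. It can do so only across the chord, so it completes \<open>f\<close>, \<open>g\<close>
    and a square of \<open>C\<close> to a two by two block (\<open>chord_pins_one_arc\<close>). With \<open>f = g\<close> this says that
    the boundary visits each square in one contiguous stretch, so \<open>H\<close> is a cycle of distinct
    squares. With \<open>f \<noteq> g\<close> it says that touching squares of \<open>H\<close> are consecutive or are separated by
    a single square whose only neighbours in \<open>H\<close> are these two.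

  \<^item> As a consequence \<open>H\<close> has, up to rotation and reversal, no other cyclic arrangement with touching
    neighbours (\<open>boundary_squares_cycle_unique\<close>): a chord between \<open>f\<close> and \<open>g\<close> would force the
    arrangement to close up to a triangle, but there are at least four boundary squares.

  \<^item> The boundary curve has the filled squares inside (\<open>interior_inside\<close>): the union of the filled
    squares is compact and its topological frontier lies on the curve. Exterior squares lie
    outside every cycle made of edges of squares of \<open>C \<union> L\<close>, because one can escape from them without
    crossing such an edge. Hence the boundary is the outermost boundary of every set of squares
    between \<open>H\<close> and \<open>C \<union> L\<close> (\<open>outermost_boundary_eq\<close>). Moreover, a surrounding cycle cannot miss a
    square of \<open>H\<close>: such a square would be connected to the exterior across its boundary edge and
    would not be inside (\<open>boundary_square_in_surrounding\<close>).
\<close>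

section \<open>Squares, sides and parity potentials on the grid\<close>

definition lattice_adj :: "int \<times> int \<Rightarrow> int \<times> int \<Rightarrow> bool" where
  "lattice_adj p q \<longleftrightarrow> \<bar>fst p - fst q\<bar> + \<bar>snd p - snd q\<bar> = 1"

text \<open>
  The corners in integer coordinates: the vertex \<open>(a, b)\<close> stands for the point
  \<open>(a + 1/2, b + 1/2)\<close>, the upper right corner of the square \<open>(a, b)\<close>. In this way squares and vertices
  are both pairs of integers, with the same adjacency relation \<open>lattice_adj\<close>.
\<close>

definition verts :: "square \<Rightarrow> (int \<times> int) set" where
  "verts s = {fst s - 1, fst s} \<times> {snd s - 1, snd s}"

lemma lattice_adj_sym: "lattice_adj p q \<longleftrightarrow> lattice_adj q p"
  unfolding lattice_adj_def by (simp add: abs_minus_commute)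

lemma lattice_adj_iff:
  "lattice_adj (a, b) (c, d) \<longleftrightarrow> a = c \<and> (b = d + 1 \<or> d = b + 1) \<or> b = d \<and> (a = c + 1 \<or> c = a + 1)"
  unfolding lattice_adj_def fst_conv snd_conv by presburger

lemma lattice_adj_cases:
  assumes "lattice_adj p q"
  obtains i j where "p = (i, j)" "q = (i + 1, j)" | i j where "p = (i + 1, j)" "q = (i, j)"
    | i j where "p = (i, j)" "q = (i, j + 1)" | i j where "p = (i, j + 1)" "q = (i, j)"
proof -
  obtain a b c d where pq: "p = (a, b)" "q = (c, d)" by (metis surj_pair)
  have "(c = a + 1 \<and> d = b) \<or> (a = c + 1 \<and> d = b) \<or> (c = a \<and> d = b + 1) \<or> (c = a \<and> b = d + 1)"
    using assms unfolding lattice_adj_def pq fst_conv snd_conv by presburger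
  with pq that show thesis by blast
qed

lemma side_right: "verts (i, j) \<inter> verts (i + 1, j) = {(i, j - 1), (i, j)}"
  unfolding verts_def by auto

lemma side_top: "verts (i, j) \<inter> verts (i, j + 1) = {(i - 1, j), (i, j)}"
  unfolding verts_def by auto

lemma mem_verts: "(x, y) \<in> verts (i, j) \<longleftrightarrow> (x = i - 1 \<or> x = i) \<and> (y = j - 1 \<or> y = j)"
  unfolding verts_def by auto

text \<open>
  Edges are handled throughout as intersections \<open>verts s \<inter> verts t\<close> for adjacent squares \<open>s\<close> and \<open>t\<close>.
  This form displays the two squares on either side, and it is no restriction.
\<close>

lemma unit_edge_side:
  assumes "lattice_adj p q" "{p, q} \<subseteq> verts s"
  obtains t where "lattice_adj s t" "{p, q} = verts s \<inter> verts t"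
proof -
  obtain i j where s: "s = (i, j)" by (metis surj_pair)
  have adj: "lattice_adj (i, j) (i + 1, j)" "lattice_adj (i, j) (i - 1, j)"
    "lattice_adj (i, j) (i, j + 1)" "lattice_adj (i, j) (i, j - 1)"
    by (auto simp: lattice_adj_def)
  have left: "verts (i, j) \<inter> verts (i - 1, j) = {(i - 1, j - 1), (i - 1, j)}"
    and bot: "verts (i, j) \<inter> verts (i, j - 1) = {(i - 1, j - 1), (i, j - 1)}"
    unfolding verts_def by auto
  obtain a b c d where pq: "p = (a, b)" "q = (c, d)" by (metis surj_pair)
  have "a = c \<and> (d = b + 1 \<or> b = d + 1) \<or> b = d \<and> (c = a + 1 \<or> a = c + 1)"
    using assms(1) unfolding lattice_adj_def pq fst_conv snd_conv by presburger
  moreover have "(a = i - 1 \<or> a = i) \<and> (b = j - 1 \<or> b = j)" "(c = i - 1 \<or> c = i) \<and> (d = j - 1 \<or> d = j)"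
    using assms(2) by (simp_all add: pq s mem_verts)
  ultimately have "{p, q} = {(i, j - 1), (i, j)} \<or> {p, q} = {(i - 1, j - 1), (i - 1, j)}
      \<or> {p, q} = {(i - 1, j), (i, j)} \<or> {p, q} = {(i - 1, j - 1), (i, j - 1)}"
    unfolding pq doubleton_eq_iff prod.inject by presburger
  then show thesis
    using that[of "(i + 1, j)"] that[of "(i - 1, j)"] that[of "(i, j + 1)"] that[of "(i, j - 1)"] adj
    unfolding s side_right side_top left bot by metis
qed

lemma side_unit_edge:
  assumes "lattice_adj s t"
  obtains p q where "lattice_adj p q" "verts s \<inter> verts t = {p, q}"
proof -
  have adj: "lattice_adj (i, j - 1) (i, j)" "lattice_adj (i - 1, j) (i, j)" for i j
    by (simp_all add: lattice_adj_def)
  from assms show thesis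
    by (rule lattice_adj_cases) (metis that adj side_right side_top Int_commute)+
qed

lemma side_determines_squares:
  assumes "lattice_adj s t" "verts s \<inter> verts t \<subseteq> verts r"
  shows "r = s \<or> r = t"
proof -
  obtain a b where r: "r = (a, b)" by (metis surj_pair)
  have right: "(a, b) = (i, j) \<or> (a, b) = (i + 1, j)"
    if "verts (i, j) \<inter> verts (i + 1, j) \<subseteq> verts (a, b)" for i j
    using that unfolding side_right insert_subset mem_verts by (simp, presburger)
  have top: "(a, b) = (i, j) \<or> (a, b) = (i, j + 1)"
    if "verts (i, j) \<inter> verts (i, j + 1) \<subseteq> verts (a, b)" for i j
    using that unfolding side_top insert_subset mem_verts by (simp, presburger)
  from assms(1) show ?thesis
    by (rule lattice_adj_cases) (use assms(2) right top in \<open>metis r Int_commute\<close>)+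
qed

lemma side_inject:
  assumes "lattice_adj s t" "lattice_adj s' t'" "verts s \<inter> verts t = verts s' \<inter> verts t'"
  shows "s = s' \<and> t = t' \<or> s = t' \<and> t = s'"
proof -
  have "s \<noteq> t" using assms(1) by (auto simp: lattice_adj_def)
  moreover have "s = s' \<or> s = t'" "t = s' \<or> t = t'"
    using side_determines_squares[OF assms(2), of s] side_determines_squares[OF assms(2), of t]
      assms(3) by blast+
  ultimately show ?thesis by metis
qed

definition edge_boundary :: "square set \<Rightarrow> (int \<times> int) set set" where
  "edge_boundary D = {verts s \<inter> verts t | s t. lattice_adj s t \<and> s \<in> D \<and> t \<notin> D}"

lemma side_in_edge_boundary:
  assumes "lattice_adj s t"
  shows "verts s \<inter> verts t \<in> edge_boundary D \<longleftrightarrow> (s \<in> D) \<noteq> (t \<in> D)"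
proof
  assume "verts s \<inter> verts t \<in> edge_boundary D"
  then obtain s' t' where "lattice_adj s' t'" "s' \<in> D" "t' \<notin> D" "verts s \<inter> verts t = verts s' \<inter> verts t'"
    unfolding edge_boundary_def by auto
  with side_inject[OF assms this(1) this(4)] show "(s \<in> D) \<noteq> (t \<in> D)" by auto
next
  assume "(s \<in> D) \<noteq> (t \<in> D)"
  then show "verts s \<inter> verts t \<in> edge_boundary D"
    using assms lattice_adj_sym[of s t] Int_commute[of "verts s" "verts t"] unfolding edge_boundary_def
    by (cases "s \<in> D") fastforce+
qed

text \<open>
  Parity of the number of edges of \<open>Z\<close> at a vertex, as an exclusive or over the four possible edges.
  Since it is additive under symmetric difference, it is the boundary map of chains modulo 2.
\<close>

definition odd_degree :: "(int \<times> int) set set \<Rightarrow> int \<times> int \<Rightarrow> bool" where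
  "odd_degree Z v \<longleftrightarrow> (case v of (i, j) \<Rightarrow>
     (({(i, j), (i + 1, j)} \<in> Z) \<noteq> ({(i - 1, j), (i, j)} \<in> Z)) \<noteq>
     (({(i, j), (i, j + 1)} \<in> Z) \<noteq> ({(i, j - 1), (i, j)} \<in> Z)))"

lemma odd_degree_sym_diff: "odd_degree (sym_diff Y Z) v \<longleftrightarrow> odd_degree Y v \<noteq> odd_degree Z v"
  unfolding odd_degree_def by (cases v) (simp only: case_prod_conv Un_iff Diff_iff, satx)

lemma odd_degree_single:
  assumes "lattice_adj a b"
  shows "odd_degree {{a, b}} v \<longleftrightarrow> (v = a) \<noteq> (v = b)"
  using assms
  by (rule lattice_adj_cases; cases v) (auto simp: odd_degree_def doubleton_eq_iff)

text \<open>
  Walking once around a vertex, one changes between \<open>D\<close> and its complement an even number of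
  times.
\<close>

lemma edge_boundary_even: "\<not> odd_degree (edge_boundary D) v"
proof -
  obtain i j where v: "v = (i, j)" by (metis surj_pair)
  have adj: "lattice_adj (i + 1, j) (i + 1, j + 1)" "lattice_adj (i, j) (i, j + 1)"
     "lattice_adj (i, j + 1) (i + 1, j + 1)" "lattice_adj (i, j) (i + 1, j)"
    by (auto simp: lattice_adj_def)
  have "{(i, j), (i + 1, j)} = verts (i + 1, j) \<inter> verts (i + 1, j + 1)"
    "{(i - 1, j), (i, j)} = verts (i, j) \<inter> verts (i, j + 1)"
    "{(i, j), (i, j + 1)} = verts (i, j + 1) \<inter> verts (i + 1, j + 1)"
    "{(i, j - 1), (i, j)} = verts (i, j) \<inter> verts (i + 1, j)"
    unfolding side_top side_right using side_right[of i "j + 1"] side_top[of "i + 1" j] by auto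
  then show ?thesis
    unfolding odd_degree_def v case_prod_conv using adj[THEN side_in_edge_boundary[of _ _ D]] by metis
qed

text \<open>
  The substitute for the Jordan curve theorem. The potential of a square is the parity of the number
  of edges of \<open>Z\<close> met by the vertical ray going up from it. It obviously jumps across horizontal edges
  of \<open>Z\<close> only; for vertical edges, the even degrees of the vertices between two neighbouring columns
  allow an induction down these columns, starting above all of \<open>Z\<close>.
\<close>

lemma even_edge_set_potential:
  fixes Z :: "(int \<times> int) set set"
  assumes "finite Z" and even: "\<And>v. \<not> odd_degree Z v"
  obtains n M where "\<And>s t. lattice_adj s t \<Longrightarrow> n s \<noteq> n t \<longleftrightarrow> verts s \<inter> verts t \<in> Z"
    and "\<And>i j :: int. j > M \<Longrightarrow> \<not> n (i, j)"
proof -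
  define A where "A i j = {k. j \<le> k \<and> {(i - 1, k), (i, k)} \<in> Z}" for i j :: int
  define n where "n s \<longleftrightarrow> odd (card (A (fst s) (snd s)))" for s
  have finA: "finite (A i j)" for i j
  proof -
    have "inj_on (\<lambda>k. {(i - 1, k), (i, k)}) UNIV"
      by (auto simp: inj_on_def doubleton_eq_iff)
    then have "finite ((\<lambda>k. {(i - 1, k), (i, k)}) -` Z)"
      using finite_vimageI[OF assms(1)] by blast
    then show ?thesis by (rule finite_subset[rotated]) (auto simp: A_def)
  qed
  have up: "n (i, j) \<longleftrightarrow> n (i, j + 1) \<noteq> ({(i - 1, j), (i, j)} \<in> Z)" for i j
  proof -
    have "A i j = (if {(i - 1, j), (i, j)} \<in> Z then insert j (A i (j + 1)) else A i (j + 1))"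
      by (auto simp: A_def) (metis add1_zle_eq order_le_less)+
    moreover have "j \<notin> A i (j + 1)" by (auto simp: A_def)
    ultimately show ?thesis using finA[of i "j + 1"] by (simp add: n_def)
  qed
  have fin: "finite (snd ` \<Union>{e \<in> Z. finite e})" (is "finite ?Y")
    by (intro finite_imageI finite_Union) (use assms(1) in auto)
  define M where "M = Max (insert 0 ?Y)"
  have M: "snd p \<le> M" if "e \<in> Z" "finite e" "p \<in> e" for e p
    unfolding M_def by (rule Max_ge) (use fin that in auto)
  have high: "\<not> n (i, j)" if "j > M" for i j
  proof -
    have "A i j = {}"
    proof (rule ccontr)
      assume "A i j \<noteq> {}"
      then obtain k where "j \<le> k" "{(i - 1, k), (i, k)} \<in> Z" by (auto simp: A_def)
      with M[of "{(i - 1, k), (i, k)}" "(i, k)"] that show False by auto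
    qed
    then show ?thesis by (simp add: n_def)
  qed
  have right: "n (i, j) \<noteq> n (i + 1, j) \<longleftrightarrow> {(i, j - 1), (i, j)} \<in> Z" for i j
  proof (cases "j > M + 1")
    case True
    then show ?thesis using high M[of "{(i, j - 1), (i, j)}" "(i, j)"] by auto
  next
    case False
    then have "j \<le> M + 2" by simp
    then show ?thesis
    proof (induction j rule: int_le_induct)
      case base
      show ?case using high[of "M + 2" i] high[of "M + 2" "i + 1"]
          M[of "{(i, M + 2 - 1), (i, M + 2)}" "(i, M + 2)"] by auto
    next
      case (step j)
      (* One step down the column: both potentials change by a horizontal edge at the vertex
         (i, j - 1), and the even degree there balances this against the two vertical edges. *)
      have "\<not> odd_degree Z (i, j - 1)" by (rule even)
      then show ?case using step.IH up[of i "j - 1"] up[of "i + 1" "j - 1"]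
        unfolding odd_degree_def by (simp, argo)
    qed
  qed
  show thesis
  proof (rule that)
    fix s t assume "lattice_adj s t"
    then show "n s \<noteq> n t \<longleftrightarrow> verts s \<inter> verts t \<in> Z"
    proof (rule lattice_adj_cases)
      fix i j assume "s = (i, j)" "t = (i + 1, j)"
      then show ?thesis using right side_right by simp
    next
      fix i j assume "s = (i + 1, j)" "t = (i, j)"
      then show ?thesis using right[of i j] side_right[of i j] by (metis Int_commute)
    next
      fix i j assume "s = (i, j)" "t = (i, j + 1)"
      then show ?thesis using up[of i j] side_top[of i j] by metis
    next
      fix i j assume "s = (i, j + 1)" "t = (i, j)"
      then show ?thesis using up[of i j] side_top[of i j] by (metis Int_commute)
    qed
  qed (rule high)
qed

section \<open>Cycles of grid edges\<close>

text \<open>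
  A cycle of length \<open>m\<close> as a periodic function on all natural numbers, so that every arc is a
  plain interval of indices and no starting point is distinguished. The bound excludes walking back
  and forth along one edge.
\<close>

definition cyclic :: "nat \<Rightarrow> (nat \<Rightarrow> 'a) \<Rightarrow> bool" where
  "cyclic m v \<longleftrightarrow> 3 \<le> m \<and> (\<forall>k l. v k = v l \<longleftrightarrow> k mod m = l mod m)"

definition nth_edge :: "(nat \<Rightarrow> 'a) \<Rightarrow> nat \<Rightarrow> 'a set" where
  "nth_edge v k = {v k, v (Suc k)}"

lemma cyclic_eq: "cyclic m v \<Longrightarrow> v k = v l \<longleftrightarrow> k mod m = l mod m"
  unfolding cyclic_def by blast

lemma cyclic_shift:
  assumes "cyclic m v"
  shows "cyclic m (\<lambda>k. v (k + j))"
proof -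
  have "(k + j) mod m = (l + j) mod m \<longleftrightarrow> k mod m = l mod m" for k l
    unfolding of_nat_eq_iff[where ?'a = int, symmetric] zmod_int of_nat_add mod_eq_dvd_iff by simp
  with assms show ?thesis unfolding cyclic_def by simp
qed

lemma mod_eq_within_period:
  fixes k l m :: nat
  assumes "k mod m = l mod m" "k < l + m" "l < k + m"
  shows "k = l"
  using assms by (metis add_less_imp_less_left linorder_neqE_nat mod_eq_dvd_iff_nat
      nat_dvd_not_less le_add_diff_inverse less_imp_le zero_less_diff)

lemma nth_edge_eq_iff:
  assumes "cyclic m v"
  shows "nth_edge v k = nth_edge v l \<longleftrightarrow> k mod m = l mod m"
proof
  assume eq: "nth_edge v k = nth_edge v l"
  show "k mod m = l mod m"
  proof (rule ccontr)
    assume ne: "k mod m \<noteq> l mod m"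
    with eq have "v k = v (Suc l)" "v (Suc k) = v l"
      using assms by (auto simp: nth_edge_def doubleton_eq_iff cyclic_eq)
    then have "k mod m = Suc l mod m" "Suc k mod m = l mod m"
      using assms by (simp_all add: cyclic_eq)
    then have "Suc (Suc l) mod m = l mod m"
      by (metis mod_Suc_eq)
    moreover have "3 \<le> m" using assms by (simp add: cyclic_def)
    ultimately show False
      using mod_eq_within_period[of "Suc (Suc l)" m l] by simp
  qed
next
  assume eq: "k mod m = l mod m"
  then have "Suc k mod m = Suc l mod m" by (metis mod_Suc_eq)
  with eq have "v k = v l" "v (Suc k) = v (Suc l)" using cyclic_eq[OF assms] by blast+
  then show "nth_edge v k = nth_edge v l" by (simp add: nth_edge_def)
qed

lemma range_nth_edge_period:
  assumes "cyclic m v"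
  shows "range (nth_edge v) = nth_edge v ` {p..<p + m}"
proof -
  have "nth_edge v k \<in> nth_edge v ` {p..<p + m}" for k
  proof -
    have m: "m > 0" using assms by (simp add: cyclic_def)
    define l where "l = p + (k + (m - 1) * p) mod m"
    have "l mod m = (p + (k + (m - 1) * p)) mod m"
      unfolding l_def by (simp add: mod_add_right_eq)
    also have "p + (k + (m - 1) * p) = k + m * p"
      using m by (cases m) auto
    finally have "l mod m = k mod m" by simp
    then have "nth_edge v k = nth_edge v l" using nth_edge_eq_iff[OF assms] by metis
    moreover have "l \<in> {p..<p + m}" using m by (simp add: l_def)
    ultimately show ?thesis by blast
  qed
  then show ?thesis by auto
qed

text \<open>
  An arc has odd degree only at its two ends; a full turn, where the ends agree, is even.
\<close>

lemma odd_degree_arc: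
  assumes "cyclic m v" and adj: "\<And>k. lattice_adj (v k) (v (Suc k))"
    and "p \<le> q" "q \<le> p + m"
  shows "odd_degree (nth_edge v ` {p..<q}) x \<longleftrightarrow> (x = v p) \<noteq> (x = v q)"
  using assms(3,4)
proof (induction q rule: dec_induct)
  case base
  show ?case by (cases x) (simp add: odd_degree_def)
next
  case (step q)
  have "nth_edge v q \<notin> nth_edge v ` {p..<q}"
  proof
    assume "nth_edge v q \<in> nth_edge v ` {p..<q}"
    then obtain k where k: "p \<le> k" "k < q" "nth_edge v q = nth_edge v k" by auto
    then have "q mod m = k mod m" using nth_edge_eq_iff[OF assms(1)] by blast
    then have "q = k" by (rule mod_eq_within_period) (use k step.prems in auto)
    with k show False by simp
  qed
  then have "nth_edge v ` {p..<Suc q} = sym_diff (nth_edge v ` {p..<q}) {{v q, v (Suc q)}}"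
    using step.hyps by (auto simp: atLeastLessThanSuc nth_edge_def)
  then show ?case
    using step.IH step.prems by (auto simp: odd_degree_sym_diff odd_degree_single[OF adj])
qed

lemma even_degree_other_edge:
  assumes "\<not> odd_degree Z a" "{a, c} \<in> Z" "lattice_adj a c"
  obtains b where "b \<noteq> c" "{a, b} \<in> Z" "lattice_adj a b"
proof -
  obtain i j where a: "a = (i, j)" by (metis surj_pair)
  let ?N = "{(i + 1, j), (i - 1, j), (i, j + 1), (i, j - 1)}"
  have adj: "lattice_adj a b" if "b \<in> ?N" for b
    using that by (auto simp: a lattice_adj_def)
  have "c \<in> ?N"
    using assms(3) unfolding a by (rule lattice_adj_cases) auto
  moreover have "((({a, (i + 1, j)} \<in> Z) \<noteq> ({a, (i - 1, j)} \<in> Z)) \<noteq>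
      (({a, (i, j + 1)} \<in> Z) \<noteq> ({a, (i, j - 1)} \<in> Z))) = False"
    using assms(1) unfolding odd_degree_def a by (simp add: insert_commute)
  ultimately have "\<exists>b\<in>?N. b \<noteq> c \<and> {a, b} \<in> Z"
    using assms(2) by auto
  with adj that show thesis by blast
qed

text \<open>
  A longest path cannot be extended at its first vertex. By parity that vertex has a second edge, and
  this edge must return to the path, which closes a cycle.
\<close>

lemma even_edge_set_has_cycle:
  fixes Z :: "(int \<times> int) set set"
  assumes "finite Z" "Z \<noteq> {}"
    and unit: "\<And>e. e \<in> Z \<Longrightarrow> \<exists>a b. lattice_adj a b \<and> e = {a, b}"
    and even: "\<And>x. \<not> odd_degree Z x"
  obtains m v where "cyclic m v" "range (nth_edge v) \<subseteq> Z"
proof -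
  define path where "path ws \<longleftrightarrow> 2 \<le> length ws \<and> distinct ws \<and>
    (\<forall>i. Suc i < length ws \<longrightarrow> {ws ! i, ws ! Suc i} \<in> Z)" for ws :: "(int \<times> int) list"
  obtain a b where ab: "lattice_adj a b" "{a, b} \<in> Z" using assms(2) unit by blast
  then have "path [a, b]"
    by (auto simp: path_def less_Suc_eq lattice_adj_def)
  moreover have "length ws < Suc (card (\<Union>Z))" if "path ws" for ws
  proof -
    have "set ws \<subseteq> \<Union>Z"
    proof
      fix x assume "x \<in> set ws"
      then obtain i where i: "i < length ws" "ws ! i = x" by (auto simp: in_set_conv_nth)
      show "x \<in> \<Union>Z"
      proof (cases "Suc i < length ws")
        case True
        then show ?thesis using that i by (auto simp: path_def)
      next
        case False
        then have i1: "Suc (i - 1) = i"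
          using that i by (auto simp: path_def)
        then have "{ws ! (i - 1), ws ! Suc (i - 1)} \<in> Z"
          using that i(1) unfolding path_def by metis
        then show ?thesis using i i1 by auto
      qed
    qed
    moreover have "finite (\<Union>Z)" using assms(1) unit by fastforce
    ultimately show ?thesis using that by (metis card_mono distinct_card less_Suc_eq_le path_def)
  qed
  ultimately obtain ws where ws: "path ws" and longest: "\<And>ws'. path ws' \<Longrightarrow> length ws' \<le> length ws"
    using ex_has_greatest_nat[of path _ length] by metis
  have len: "2 \<le> length ws" and dist: "distinct ws" using ws by (auto simp: path_def)
  have first: "{ws ! 0, ws ! 1} \<in> Z" using ws by (auto simp: path_def)
  moreover have "lattice_adj (ws ! 0) (ws ! 1)"
    using unit[OF first] by (metis doubleton_eq_iff lattice_adj_sym)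
  ultimately obtain b where b: "b \<noteq> ws ! 1" "{ws ! 0, b} \<in> Z" "lattice_adj (ws ! 0) b"
    using even_degree_other_edge[OF even] by metis
  have "b \<in> set ws"
  proof (rule ccontr)
    assume "b \<notin> set ws"
    then have "path (b # ws)"
      using ws b by (auto simp: path_def nth_Cons insert_commute split: nat.split)
    from longest[OF this] show False by simp
  qed
  then obtain k where k: "k < length ws" "ws ! k = b" by (auto simp: in_set_conv_nth)
  have "k \<noteq> 0"
  proof
    assume "k = 0"
    with k b(3) show False by (simp add: lattice_adj_def)
  qed
  moreover have "k \<noteq> 1" using k b by auto
  ultimately have k2: "2 \<le> k" by simp
  define v where "v i = ws ! (i mod Suc k)" for i
  have "cyclic (Suc k) v"
    unfolding cyclic_def v_def
  proof (intro conjI allI)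
    show "3 \<le> Suc k" using k2 by simp
    fix i l
    have "i mod Suc k < length ws" "l mod Suc k < length ws"
      using k(1) by (meson mod_less_divisor less_Suc_eq_le order_le_less_trans zero_less_Suc)+
    then show "ws ! (i mod Suc k) = ws ! (l mod Suc k) \<longleftrightarrow> i mod Suc k = l mod Suc k"
      using dist by (simp add: nth_eq_iff_index_eq)
  qed
  moreover have "nth_edge v i \<in> Z" for i
  proof (cases "i mod Suc k = k")
    case True
    then have "Suc i mod Suc k = 0" by (simp add: mod_Suc)
    then show ?thesis using True b k by (simp add: nth_edge_def v_def insert_commute)
  next
    case False
    moreover have "i mod Suc k < Suc k" by simp
    ultimately have "Suc i mod Suc k = Suc (i mod Suc k)" "Suc (i mod Suc k) < length ws"
      using k(1) by (simp add: mod_Suc, linarith)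
    then show ?thesis using ws by (simp add: nth_edge_def v_def path_def)
  qed
  ultimately show thesis using that by blast
qed

section \<open>The exterior of a finite set of squares\<close>

text \<open>
  Escaping to infinity is encoded as reaching a square at and above whose height there is nothing of
  \<open>X\<close>; for finite \<open>X\<close> all such heights are connected to each other around \<open>X\<close>.
\<close>

definition exterior :: "square set \<Rightarrow> square set" where
  "exterior X = {s. \<exists>t. (\<forall>r. snd t \<le> snd r \<longrightarrow> r \<notin> X) \<and>
     (s, t) \<in> {(a, b). a \<notin> X \<and> b \<notin> X \<and> lattice_adj a b}\<^sup>*}"

lemma exterior_disjoint: "s \<in> exterior X \<Longrightarrow> s \<notin> X"
  unfolding exterior_def by (auto elim: converse_rtranclE)

lemma exterior_step:
  assumes "s \<in> exterior X" "lattice_adj s t" "t \<notin> X"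
  shows "t \<in> exterior X"
proof -
  have "(t, s) \<in> {(a, b). a \<notin> X \<and> b \<notin> X \<and> lattice_adj a b}"
    using assms exterior_disjoint lattice_adj_sym by blast
  with assms(1) show ?thesis
    unfolding exterior_def by (blast intro: converse_rtrancl_into_rtrancl)
qed

lemma exterior_above: "(\<And>r. snd s \<le> snd r \<Longrightarrow> r \<notin> X) \<Longrightarrow> s \<in> exterior X"
  unfolding exterior_def by blast

text \<open>
  Induction along an escape route, read backwards from its end.
\<close>

lemma exterior_induct [consumes 1, case_names above step]:
  assumes "s \<in> exterior X"
    and above: "\<And>s. (\<And>r. snd s \<le> snd r \<Longrightarrow> r \<notin> X) \<Longrightarrow> P s"
    and step: "\<And>s t. s \<in> exterior X \<Longrightarrow> t \<in> exterior X \<Longrightarrow> lattice_adj s t \<Longrightarrow> P t \<Longrightarrow> P s"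
  shows "P s"
proof -
  obtain t where t: "\<And>r. snd t \<le> snd r \<Longrightarrow> r \<notin> X"
    and st: "(s, t) \<in> {(a, b). a \<notin> X \<and> b \<notin> X \<and> lattice_adj a b}\<^sup>*"
    using assms(1) unfolding exterior_def by blast
  from st have "P s \<and> s \<in> exterior X"
  proof (induction rule: converse_rtrancl_induct)
    case base
    show ?case using above[of t] exterior_above[of t] t by blast
  next
    case (step y z)
    then show ?case using assms(3)[of y z] exterior_step[of z X y] lattice_adj_sym[of y z] by blast
  qed
  then show ?thesis ..
qed

text \<open>
  Going straight up from the end of an escape route stays in the exterior and reaches the heights at
  which \<open>n\<close> is known.
\<close>

lemma exterior_no_jump:
  assumes "s \<in> exterior X"
    and no_jump: "\<And>s t. s \<in> exterior X \<Longrightarrow> t \<in> exterior X \<Longrightarrow> lattice_adj s t \<Longrightarrow> n s \<longleftrightarrow> n t"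
    and high: "\<And>i j. j > M \<Longrightarrow> \<not> n (i, j)"
  shows "\<not> n s"
  using assms(1)
proof (induction rule: exterior_induct)
  case (above s)
  obtain i j where s: "s = (i, j)" by (metis surj_pair)
  have ext: "(i, k) \<in> exterior X" if "j \<le> k" for k
    using that above by (intro exterior_above) (auto simp: s)
  have "n (i, j) \<longleftrightarrow> n (i, k)" if "j \<le> k" for k
    using that
  proof (induction k rule: int_ge_induct)
    case (step k)
    then show ?case using no_jump[OF ext[of k] ext[of "k + 1"]] by (simp add: lattice_adj_def)
  qed simp
  from this[of "max j (M + 1)"] high[of "max j (M + 1)" i] show ?case by (simp add: s)
next
  case (step s t)
  then show ?case using no_jump by blast
qed

text \<open>
  Above a bounding box everything is exterior by definition. Columns that avoid \<open>X\<close> are reached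
  downwards from there, and rows that avoid \<open>X\<close> sideways from a column to the right of the box. So a
  square outside the exterior shares its column and its row with squares of \<open>X\<close>.
\<close>

lemma finite_non_exterior:
  assumes "finite X"
  shows "finite (- exterior X)"
proof -
  let ?Y = "(\<lambda>s. \<bar>fst s\<bar>) ` X \<union> (\<lambda>s. \<bar>snd s\<bar>) ` X"
  define N where "N = Max (insert 0 ?Y)"
  have N: "\<bar>fst s\<bar> \<le> N \<and> \<bar>snd s\<bar> \<le> N" if "s \<in> X" for s
    unfolding N_def by (intro conjI Max_ge) (use that assms in auto)
  have adj: "lattice_adj (i, j) (i, j - 1)" "lattice_adj (i, j) (i - 1, j)" for i j
    by (auto simp: lattice_adj_def)
  have high: "(i, j) \<in> exterior X" if "j > N" for i j
    using that N by (intro exterior_above) force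
  have column: "(i, j) \<in> exterior X" if "\<And>k. (i, k) \<notin> X" for i j
  proof (cases "j > N")
    case False
    then have "j \<le> N + 1" by simp
    then show ?thesis
    proof (induction j rule: int_le_induct)
      case base
      show ?case using high[of "N + 1" i] by simp
    next
      case (step j)
      then show ?case using exterior_step[OF _ adj(1)] that by blast
    qed
  qed (rule high)
  have row: "(i, j) \<in> exterior X" if "\<And>k. (k, j) \<notin> X" for i j
  proof (cases "i > N")
    case False
    then have "i \<le> N + 1" by simp
    then show ?thesis
    proof (induction i rule: int_le_induct)
      case base
      show ?case by (rule column) (use N[of "(N + 1, _)"] in force)
    next
      case (step i)
      then show ?case using exterior_step[OF _ adj(2)] that by blast
    qed
  next
    case True
    then show ?thesis by (intro column) (use N[of "(i, _)"] in force)
  qed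
  have "- exterior X \<subseteq> {-N..N} \<times> {-N..N}"
  proof (intro subsetI)
    fix s assume s: "s \<in> - exterior X"
    obtain i j where ij: "s = (i, j)" by (metis surj_pair)
    from s column[of i j] row[of j i] obtain k l where "(i, k) \<in> X" "(l, j) \<in> X"
      unfolding ij by blast
    from N[OF this(1)] N[OF this(2)] show "s \<in> {-N..N} \<times> {-N..N}" by (auto simp: ij)
  qed
  then show ?thesis by (rule finite_subset) simp
qed

section \<open>Blocks of four squares\<close>

text \<open>
  Squares that share only a corner have two common edge neighbours, which complete the block around
  that corner.
\<close>

lemma touching_squares:
  assumes "verts s \<inter> verts t \<noteq> {}" "s \<noteq> t" "\<not> lattice_adj s t"
  obtains a b where "a \<noteq> b" "lattice_adj s a" "lattice_adj t a" "lattice_adj s b" "lattice_adj t b"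
proof -
  obtain i j k l where st: "s = (i, j)" "t = (k, l)" by (metis surj_pair)
  obtain x y where "(x, y) \<in> verts s" "(x, y) \<in> verts t" using assms(1) by auto
  then have "\<bar>i - k\<bar> \<le> 1" "\<bar>j - l\<bar> \<le> 1" unfolding st mem_verts by linarith+
  moreover have "i \<noteq> k \<or> j \<noteq> l" "\<bar>i - k\<bar> + \<bar>j - l\<bar> \<noteq> 1"
    using assms(2,3) by (auto simp: st lattice_adj_def)
  ultimately have "\<bar>i - k\<bar> = 1" "\<bar>j - l\<bar> = 1" by linarith+
  then show thesis
    using that[of "(i, l)" "(k, j)"] by (simp add: st lattice_adj_def abs_minus_commute, linarith)
qed

lemma block_shape:
  assumes "lattice_adj u f" "lattice_adj c f" "lattice_adj u g" "lattice_adj c g" "f \<noteq> g" "u \<noteq> c"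
  shows "\<bar>fst u - fst c\<bar> = 1" "\<bar>snd u - snd c\<bar> = 1"
    "{f, g} = {(fst u, snd c), (fst c, snd u)}"
proof -
  obtain a b where u: "u = (a, b)" by (metis surj_pair)
  obtain a' b' where c: "c = (a', b')" by (metis surj_pair)
  obtain i j where f: "f = (i, j)" by (metis surj_pair)
  obtain k l where g: "g = (k, l)" by (metis surj_pair)
  have uf: "lattice_adj (a, b) (i, j)" and cf: "lattice_adj (a', b') (i, j)"
    and ug: "lattice_adj (a, b) (k, l)" and cg: "lattice_adj (a', b') (k, l)"
    and ne: "i \<noteq> k \<or> j \<noteq> l" "a \<noteq> a' \<or> b \<noteq> b'"
    using assms unfolding u c f g by auto
  (* squares two apart in a row or column have a single common neighbour *)
  have col: "x = a \<and> 2 * y = b + b'" if "lattice_adj (a, b) (x, y)" "lattice_adj (a, b') (x, y)" "b \<noteq> b'" for x y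
    using that unfolding lattice_adj_iff by (elim disjE conjE) simp_all
  have row: "y = b \<and> 2 * x = a + a'" if "lattice_adj (a, b) (x, y)" "lattice_adj (a', b) (x, y)" "a \<noteq> a'" for x y
    using that unfolding lattice_adj_iff by (elim disjE conjE) simp_all
  have "a \<noteq> a'" using col[of i j] col[of k l] uf cf ug cg ne by auto
  moreover have "b \<noteq> b'" using row[of i j] row[of k l] uf cf ug cg ne by auto
  ultimately have diag: "\<bar>a - a'\<bar> = 1" "\<bar>b - b'\<bar> = 1"
    using uf cf unfolding lattice_adj_iff by (elim disjE conjE; simp)+
  have "i = a \<and> j = b' \<or> i = a' \<and> j = b"
    using uf cf diag unfolding lattice_adj_iff by (elim disjE conjE; simp)
  moreover have "k = a \<and> l = b' \<or> k = a' \<and> l = b"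
    using ug cg diag unfolding lattice_adj_iff by (elim disjE conjE; simp)
  ultimately show "\<bar>fst u - fst c\<bar> = 1" "\<bar>snd u - snd c\<bar> = 1"
    "{f, g} = {(fst u, snd c), (fst c, snd u)}"
    using ne(1) diag by (auto simp: u c f g)
qed

lemma block_vertex:
  assumes "lattice_adj u f" "lattice_adj c f" "lattice_adj u g" "lattice_adj c g" "f \<noteq> g" "u \<noteq> c"
  obtains x where "\<And>t. x \<in> verts t \<longleftrightarrow> t \<in> {u, f, g, c}"
proof -
  obtain a b where u: "u = (a, b)" by (metis surj_pair)
  obtain a' b' where c: "c = (a', b')" by (metis surj_pair)
  have "{u, f, g, c} = insert u (insert c {f, g})" by blast
  also have "\<dots> = {a, a'} \<times> {b, b'}"
    unfolding block_shape(3)[OF assms] by (auto simp: u c)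
  finally have "{u, f, g, c} = {a, a'} \<times> {b, b'}" .
  moreover have "\<bar>a - a'\<bar> = 1" "\<bar>b - b'\<bar> = 1"
    using block_shape(1,2)[OF assms] by (simp_all add: u c)
  then have "{a, a'} = {min a a', min a a' + 1}" "{b, b'} = {min b b', min b b' + 1}" by auto
  ultimately have "{u, f, g, c} = {min a a', min a a' + 1} \<times> {min b b', min b b' + 1}" by simp
  moreover have "(x, y) \<in> verts t \<longleftrightarrow> t \<in> {x, x + 1} \<times> {y, y + 1}" for x y and t :: square
    by (cases t) (auto simp: mem_verts)
  ultimately show thesis using that[of "(min a a', min b b')"] by blast
qed

text \<open>
  The grid is bipartite.
\<close>

lemma lattice_adj_no_triangle: "lattice_adj a b \<Longrightarrow> lattice_adj b c \<Longrightarrow> \<not> lattice_adj a c"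
  by (cases a; cases b; cases c) (auto simp: lattice_adj_iff)

text \<open>
  Any two corners of a square can be joined along its sides. The chain turns at the vertex with the
  first coordinate of \<open>a\<close> and the second of \<open>b\<close>; one or both of its edges may be missing.
\<close>

lemma corner_chain:
  assumes "a \<in> verts s" "b \<in> verts s"
  obtains P where "finite P" "\<And>e. e \<in> P \<Longrightarrow> e \<subseteq> verts s"
    "\<And>z. odd_degree P z \<longleftrightarrow> (z = a) \<noteq> (z = b)"
proof -
  define c where "c = (fst a, snd b)"
  define Q where "Q x y = (if x = y then {} else {{x, y :: int \<times> int}})" for x y
  have "odd_degree (Q x y) z \<longleftrightarrow> (z = x) \<noteq> (z = y)" if "x = y \<or> lattice_adj x y" for x y z
  proof (cases "x = y")
    case True
    then show ?thesis by (cases z) (simp add: Q_def odd_degree_def)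
  next
    case False
    with that show ?thesis by (simp add: Q_def odd_degree_single)
  qed
  moreover have "a = c \<or> lattice_adj a c" "c = b \<or> lattice_adj c b"
    using assms by (auto simp: c_def lattice_adj_def verts_def)
  ultimately have "odd_degree (sym_diff (Q a c) (Q c b)) z \<longleftrightarrow> (z = a) \<noteq> (z = b)" for z
    by (simp add: odd_degree_sym_diff) blast
  moreover have "c \<in> verts s" using assms by (auto simp: c_def verts_def)
  then have "e \<subseteq> verts s" if "e \<in> sym_diff (Q a c) (Q c b)" for e
    using that assms by (auto simp: Q_def split: if_splits)
  moreover have "finite (sym_diff (Q a c) (Q c b))" by (simp add: Q_def)
  ultimately show thesis using that by metis
qed

section \<open>The boundary of a filled cluster is a single cycle\<close>

text \<open>
  What is needed of a finite component \<open>C\<close> and the vacant squares \<open>L\<close> around it. Here \<open>connected\<close>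
  says that \<open>C\<close> is connected across edges.
\<close>

locale enclosed_cluster =
  fixes C L :: "square set"
  assumes finite_C: "finite C" and nonempty: "C \<noteq> {}"
    and connected: "\<And>A. \<lbrakk>A \<subseteq> C; A \<noteq> {}; \<And>s t. s \<in> A \<Longrightarrow> t \<in> C \<Longrightarrow> lattice_adj s t \<Longrightarrow> t \<in> A\<rbrakk> \<Longrightarrow> A = C"
    and disjoint: "C \<inter> L = {}"
    and neighbour: "\<And>s t. s \<in> C \<Longrightarrow> lattice_adj s t \<Longrightarrow> t \<in> C \<union> L"
    and touch: "\<And>t. t \<in> L \<Longrightarrow> \<exists>s\<in>C. verts s \<inter> verts t \<noteq> {}"
begin

text \<open>
  The cluster together with its holes.
\<close>

definition filled :: "square set" where
  "filled = - exterior (C \<union> L)"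

lemma cluster_subset: "C \<union> L \<subseteq> filled"
  using exterior_disjoint by (auto simp: filled_def)

lemma finite_L: "finite L"
proof -
  have "L \<subseteq> (\<Union>s\<in>C. {fst s - 1..fst s + 1} \<times> {snd s - 1..snd s + 1})"
  proof
    fix t assume "t \<in> L"
    then obtain s x where "s \<in> C" "x \<in> verts s" "x \<in> verts t" using touch by blast
    moreover from this have "t \<in> {fst s - 1..fst s + 1} \<times> {snd s - 1..snd s + 1}"
      by (cases t) (auto simp: verts_def)
    ultimately show "t \<in> (\<Union>s\<in>C. {fst s - 1..fst s + 1} \<times> {snd s - 1..snd s + 1})" by blast
  qed
  then show ?thesis by (rule finite_subset) (simp add: finite_C)
qed

lemma finite_filled: "finite filled"
  unfolding filled_def using finite_C finite_L by (intro finite_non_exterior) simp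

lemma finite_edge_boundary_filled: "finite (edge_boundary filled)"
proof -
  have "edge_boundary filled \<subseteq> (\<Union>s\<in>filled. Pow (verts s))" by (auto simp: edge_boundary_def)
  then show ?thesis by (rule finite_subset) (simp add: finite_filled verts_def)
qed

text \<open>
  The square is in \<open>C \<union> L\<close>, for otherwise it would be exterior like its neighbour; and it is not in \<open>C\<close>,
  all of whose neighbours are in \<open>C \<union> L\<close>.
\<close>

lemma inner_square_in_L:
  assumes "s \<in> filled" "t \<notin> filled" "lattice_adj s t"
  shows "s \<in> L"
proof -
  have "t \<in> exterior (C \<union> L)" using assms(2) by (simp add: filled_def)
  then have "s \<in> C \<union> L" "t \<notin> C \<union> L"
    using assms exterior_step[of t "C \<union> L" s] exterior_disjoint lattice_adj_sym[of s t]
    by (auto simp only: filled_def Compl_iff)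
  with neighbour assms(3) show ?thesis by blast
qed

lemma C_no_jump:
  assumes "\<And>s t. s \<in> C \<Longrightarrow> t \<in> C \<Longrightarrow> lattice_adj s t \<Longrightarrow> n s \<longleftrightarrow> n t" "c \<in> C" "d \<in> C"
  shows "n c \<longleftrightarrow> n d"
proof -
  have "{s \<in> C. n s \<longleftrightarrow> n c} = C" by (rule connected) (use assms in blast)+
  with assms(3) show ?thesis by blast
qed

text \<open>
  Every straight ray from the component leaves the finite set of filled squares, and not before its
  second square. Rays in the four directions give four different boundary squares.
\<close>

lemma ray_leaves_filled:
  assumes "c \<in> C" "\<bar>a\<bar> + \<bar>b\<bar> = 1"
  obtains k s t where "k \<ge> (1 :: int)" "s = (fst c + k * a, snd c + k * b)" "s \<in> filled" "t \<notin> filled" "lattice_adj s t"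
proof -
  define r where "r k = (fst c + int k * a, snd c + int k * b)" for k
  have adj: "lattice_adj (r k) (r (Suc k))" for k
  proof -
    have "fst (r k) - fst (r (Suc k)) = - a" "snd (r k) - snd (r (Suc k)) = - b"
      by (simp_all add: r_def algebra_simps)
    with assms(2) show ?thesis by (simp add: lattice_adj_def)
  qed
  have "r 1 \<in> filled" using neighbour[OF assms(1)] adj[of 0] cluster_subset by (auto simp: r_def)
  have "\<exists>k\<ge>1. r k \<in> filled \<and> r (Suc k) \<notin> filled"
  proof (rule ccontr)
    assume *: "\<not> ?thesis"
    have "r k \<in> filled" if "1 \<le> k" for k
      using that by (induction k rule: dec_induct) (use \<open>r 1 \<in> filled\<close> * in auto)
    then have "r ` {1..} \<subseteq> filled" by auto
    moreover have "inj_on r {1..}" using assms(2) by (auto simp: inj_on_def r_def)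
    ultimately have "finite {1::nat..}" using finite_filled finite_subset finite_image_iff by metis
    then show False by (simp add: infinite_Ici)
  qed
  then obtain k where "k \<ge> 1" "r k \<in> filled" "r (Suc k) \<notin> filled" by blast
  then show thesis using that[of "int k" "r k" "r (Suc k)"] adj by (simp add: r_def)
qed

text \<open>
  The boundary contains some cycle. Its potential is constant on the connected component, extends from
  there to the squares that touch it (a diagonal contact can be replaced by two steps through a
  common neighbour, which lies in \<open>C \<union> L\<close>), and is false on the exterior. As the cycle has at least
  one edge, the two values differ, so every boundary edge is an edge of the cycle.
\<close>

lemma boundary_is_cycle:
  obtains m v where "cyclic m v" "range (nth_edge v) = edge_boundary filled"
proof -
  obtain c where c: "c \<in> C" using nonempty by blast
  obtain s t where "s \<in> filled" "t \<notin> filled" "lattice_adj s t"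
    using ray_leaves_filled[OF c, of 1 0] by (metis abs_one abs_zero add.right_neutral)
  then have "edge_boundary filled \<noteq> {}" using side_in_edge_boundary by blast
  moreover have "\<exists>a b. lattice_adj a b \<and> e = {a, b}" if "e \<in> edge_boundary filled" for e
    using that unfolding edge_boundary_def mem_Collect_eq by (metis side_unit_edge)
  ultimately obtain m v where v: "cyclic m v" "range (nth_edge v) \<subseteq> edge_boundary filled"
    using even_edge_set_has_cycle[OF finite_edge_boundary_filled] edge_boundary_even by metis
  have adj: "lattice_adj (v k) (v (Suc k))" for k
  proof -
    have "nth_edge v k \<in> edge_boundary filled" using v(2) by blast
    then obtain a b where "lattice_adj a b" "{v k, v (Suc k)} = {a, b}"
      unfolding edge_boundary_def nth_edge_def mem_Collect_eq by (metis side_unit_edge)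
    then show ?thesis by (metis doubleton_eq_iff lattice_adj_sym)
  qed
  have "v m = v 0" using cyclic_eq[OF v(1)] by simp
  then have "\<not> odd_degree (range (nth_edge v)) x" for x
    using odd_degree_arc[OF v(1) adj, of 0 m x] range_nth_edge_period[OF v(1), of 0] by simp
  then obtain n M where n: "\<And>s t. lattice_adj s t \<Longrightarrow> n s \<noteq> n t \<longleftrightarrow> verts s \<inter> verts t \<in> range (nth_edge v)"
    and high: "\<And>i j :: int. j > M \<Longrightarrow> \<not> n (i, j)"
    using even_edge_set_potential[OF finite_subset[OF v(2) finite_edge_boundary_filled]] by metis
  have same: "n s \<longleftrightarrow> n t" if "lattice_adj s t" "s \<in> filled \<longleftrightarrow> t \<in> filled" for s t
    using n[OF that(1)] side_in_edge_boundary[OF that(1)] that(2) v(2) by blast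
  have ext: "\<not> n s" if "s \<notin> filled" for s
    by (rule exterior_no_jump[of s "C \<union> L" n M]) (use that same high in \<open>auto simp only: filled_def Compl_iff\<close>)
  have n_C: "n s \<longleftrightarrow> n c" if "s \<in> C" for s
    by (rule C_no_jump) (use that c same cluster_subset in blast)+
  have n_X: "n t \<longleftrightarrow> n c" if "t \<in> C \<union> L" for t
  proof (cases "t \<in> C")
    case False
    with that obtain s where s: "s \<in> C" "verts s \<inter> verts t \<noteq> {}" using touch by blast
    then consider "lattice_adj s t" | a where "lattice_adj s a" "lattice_adj t a"
      using touching_squares[OF s(2)] False by metis
    then show ?thesis
    proof cases
      case 1
      then show ?thesis using same[of s t] n_C s(1) that cluster_subset by blast
    next
      case 2
      then have "a \<in> filled" "s \<in> filled" "t \<in> filled" using neighbour s(1) that cluster_subset by blast+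
      with 2 show ?thesis using same[of s a] same[of t a] n_C[OF s(1)] by blast
    qed
  qed (rule n_C)
  (* The potential jumps across an edge of the cycle and vanishes on its exterior side, so it is
     true on the whole cluster; hence it jumps across every boundary edge. *)
  have "nth_edge v 0 \<in> edge_boundary filled" using v(2) by blast
  then obtain s0 t0 where st0: "lattice_adj s0 t0" "s0 \<in> filled" "t0 \<notin> filled" "nth_edge v 0 = verts s0 \<inter> verts t0"
    unfolding edge_boundary_def by auto
  have "n s0" using n[OF st0(1)] st0(4) ext[OF st0(3)] by (metis rangeI)
  then have "n c" using n_X inner_square_in_L[OF st0(2,3,1)] by blast
  have "edge_boundary filled \<subseteq> range (nth_edge v)"
  proof
    fix e assume "e \<in> edge_boundary filled"
    then obtain s t where st: "lattice_adj s t" "s \<in> filled" "t \<notin> filled" "e = verts s \<inter> verts t"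
      unfolding edge_boundary_def by auto
    then have "n s" using n_X inner_square_in_L \<open>n c\<close> by blast
    then show "e \<in> range (nth_edge v)" using n[OF st(1)] ext[OF st(3)] st(4) by blast
  qed
  with v that show thesis by blast
qed

text \<open>
  The square \<open>u\<close> bridges \<open>f\<close> and \<open>g\<close>: the squares \<open>u\<close>, \<open>f\<close>, \<open>g\<close> and some square of the component opposite
  to \<open>u\<close> form a two by two block. This is the situation at a convex corner of the boundary, where \<open>f\<close>
  and \<open>g\<close> touch although \<open>u\<close> comes between them.
\<close>

definition bridges :: "square \<Rightarrow> square \<Rightarrow> square \<Rightarrow> bool" where
  "bridges f g u \<longleftrightarrow> u \<in> L \<and> f \<noteq> g \<and> lattice_adj u f \<and> lattice_adj u g \<and>
     (\<exists>c\<in>C. lattice_adj c f \<and> lattice_adj c g)"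

lemma bridges_sym: "bridges f g u \<longleftrightarrow> bridges g f u"
  unfolding bridges_def by blast

text \<open>
  The diagonal squares \<open>f\<close> and \<open>g\<close> lie in one block only, and one of the two remaining squares
  of it belongs to \<open>C\<close>.
\<close>

lemma bridges_unique:
  assumes "bridges f g u" "bridges f g u'"
  shows "u = u'"
proof -
  from assms obtain c c' where c: "c \<in> C" "lattice_adj c f" "lattice_adj c g"
    "c' \<in> C" "lattice_adj c' f" "lattice_adj c' g"
    unfolding bridges_def by blast
  from assms have u: "u \<in> L" "u' \<in> L" "f \<noteq> g" "lattice_adj u f" "lattice_adj u g"
      "lattice_adj u' f" "lattice_adj u' g"
    unfolding bridges_def by blast+
  have "u \<noteq> c" "u' \<noteq> c" using c u disjoint by auto
  then have "{u, c} = {(fst f, snd g), (fst g, snd f)}" "{u', c} = {(fst f, snd g), (fst g, snd f)}"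
    by (intro block_shape(3)[of f u g c] block_shape(3)[of f u' g c];
        use c u lattice_adj_sym in blast)+
  then show ?thesis using \<open>u \<noteq> c\<close> \<open>u' \<noteq> c\<close> by (metis doubleton_eq_iff)
qed

text \<open>
  The component is connected and avoids \<open>f\<close> and \<open>g\<close>, so \<open>n\<close> is true on all of it. A square \<open>u\<close> of \<open>L\<close>
  on which \<open>n\<close> is false nevertheless touches the component. Any edge contact, or a path of two steps
  through a common neighbour, would carry the value over unless it is blocked by \<open>f\<close> or \<open>g\<close>; so the
  contact is diagonal and both common neighbours are blocked.
\<close>

lemma separated_square_bridges:
  assumes no_jump: "\<And>s t. \<lbrakk>lattice_adj s t; s \<in> filled; t \<in> filled; s \<notin> {f, g}; t \<notin> {f, g}\<rbrakk> \<Longrightarrow> n s \<longleftrightarrow> n t"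
    and "f \<in> L" "g \<in> L" "c \<in> C" "n c" "u \<in> L" "u \<notin> {f, g}" "\<not> n u"
  shows "bridges f g u"
proof -
  have "n d" if "d \<in> C" for d
    using C_no_jump[of n c d] assms(4,5) that no_jump cluster_subset disjoint assms(2,3) by blast
  moreover obtain d where d: "d \<in> C" "verts d \<inter> verts u \<noteq> {}" using touch assms(6) by blast
  ultimately have "n d" by blast
  have in_D: "d \<in> filled" "u \<in> filled" "d \<notin> {f, g}" "d \<noteq> u"
    using d assms(2,3,6) cluster_subset disjoint by blast+
  have "\<not> lattice_adj d u" using no_jump[of d u] in_D assms(7,8) \<open>n d\<close> by blast
  then obtain a b where ab: "a \<noteq> b" "lattice_adj d a" "lattice_adj u a" "lattice_adj d b" "lattice_adj u b"
    using touching_squares[OF d(2) in_D(4)] by metis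
  have "x \<in> {f, g}" if "lattice_adj d x" "lattice_adj u x" for x
    using no_jump[of d x] no_jump[of u x] that in_D assms(7,8) \<open>n d\<close> neighbour[OF d(1)] cluster_subset by blast
  then have "a \<in> {f, g}" "b \<in> {f, g}" using ab by blast+
  then show ?thesis using ab assms(6) d(1) unfolding bridges_def by auto
qed

end

section \<open>Chords between boundary squares\<close>

locale boundary_walk = enclosed_cluster +
  fixes m :: nat and v :: "nat \<Rightarrow> int \<times> int"
  assumes cyclic_v: "cyclic m v" and range_nth_edge_v: "range (nth_edge v) = edge_boundary filled"
begin

text \<open>
  The square on the inner side of the edge number \<open>k\<close>; the choice is unique.
\<close>

definition inner :: "nat \<Rightarrow> square" where
  "inner k = (SOME s. s \<in> filled \<and> nth_edge v k \<subseteq> verts s)"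

lemma inner:
  obtains t where "lattice_adj (inner k) t" "inner k \<in> filled" "t \<notin> filled" "nth_edge v k = verts (inner k) \<inter> verts t"
proof -
  have "nth_edge v k \<in> edge_boundary filled" using range_nth_edge_v by blast
  then obtain s t where st: "lattice_adj s t" "s \<in> filled" "t \<notin> filled" "nth_edge v k = verts s \<inter> verts t"
    unfolding edge_boundary_def by auto
  then have "inner k \<in> filled \<and> nth_edge v k \<subseteq> verts (inner k)"
    unfolding inner_def by (intro someI[where P = "\<lambda>s. s \<in> filled \<and> nth_edge v k \<subseteq> verts s" and x = s]) auto
  with side_determines_squares[OF st(1)] st have "inner k = s" by metis
  with st that show thesis by blast
qed

lemma inner_in_L: "inner k \<in> L"
  using inner[of k] inner_square_in_L by metis

lemma inner_unique: "s \<in> filled \<Longrightarrow> nth_edge v k \<subseteq> verts s \<Longrightarrow> s = inner k"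
  using inner[of k] side_determines_squares by metis

lemma inner_periodic: "k mod m = l mod m \<Longrightarrow> inner k = inner l"
  using nth_edge_eq_iff[OF cyclic_v] unfolding inner_def by metis

lemma v_in_inner: "v k \<in> verts (inner k)" "v (Suc k) \<in> verts (inner k)"
  using inner[of k] by (auto simp: nth_edge_def)

lemma adj_v: "lattice_adj (v k) (v (Suc k))"
proof -
  obtain t where "lattice_adj (inner k) t" "nth_edge v k = verts (inner k) \<inter> verts t" using inner by metis
  then obtain a b where "lattice_adj a b" "{v k, v (Suc k)} = {a, b}"
    unfolding nth_edge_def by (metis side_unit_edge)
  then show ?thesis by (metis doubleton_eq_iff lattice_adj_sym)
qed

text \<open>
  The heart of the matter. Close up the arc from \<open>v p\<close> to \<open>v q\<close> by chains along the sides of the squares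
  \<open>f\<close> and \<open>g\<close> to a common corner. The result is an even set; among squares other than \<open>f\<close> and \<open>g\<close> its
  potential jumps only across the edges of the arc, and it is false on the exterior. So it is true on
  the inner squares of the arc and false on those of the complementary arc. Whatever its value on the
  component, one of the two arcs consists of squares with the other value, and
  \<open>separated_square_bridges\<close> applies to them. The squares \<open>f\<close> and \<open>g\<close> may be equal.
\<close>

lemma chord_pins_one_arc:
  assumes "p < q" "q < p + m" "verts (inner p) \<inter> verts (inner q) \<noteq> {}"
  shows "(\<forall>k\<in>{p..<q}. inner k \<in> {inner p, inner q} \<or> bridges (inner p) (inner q) (inner k)) \<or>
         (\<forall>k\<in>{q..<p + m}. inner k \<in> {inner p, inner q} \<or> bridges (inner p) (inner q) (inner k))"
proof -
  let ?f = "inner p" and ?g = "inner q" and ?A = "nth_edge v ` {p..<q}"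
  obtain x where x: "x \<in> verts ?f" "x \<in> verts ?g" using assms(3) by blast
  obtain P where P: "finite P" "\<And>e. e \<in> P \<Longrightarrow> e \<subseteq> verts ?f"
    "\<And>z. odd_degree P z \<longleftrightarrow> (z = v p) \<noteq> (z = x)"
    using corner_chain[OF v_in_inner(1) x(1)] by metis
  obtain Q where Q: "finite Q" "\<And>e. e \<in> Q \<Longrightarrow> e \<subseteq> verts ?g"
    "\<And>z. odd_degree Q z \<longleftrightarrow> (z = v q) \<noteq> (z = x)"
    using corner_chain[OF v_in_inner(1) x(2)] by metis
  define W where "W = sym_diff ?A (sym_diff P Q)"
  have "finite W" using P(1) Q(1) by (simp add: W_def)
  moreover have "\<not> odd_degree W z" for z
    using odd_degree_arc[OF cyclic_v adj_v, of p q z] assms(1,2) P(3) Q(3)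
    by (simp add: W_def odd_degree_sym_diff) blast
  ultimately obtain n M where n: "\<And>s t. lattice_adj s t \<Longrightarrow> n s \<noteq> n t \<longleftrightarrow> verts s \<inter> verts t \<in> W"
    and high: "\<And>i j :: int. j > M \<Longrightarrow> \<not> n (i, j)"
    using even_edge_set_potential by metis
  have jump: "n s \<noteq> n t \<longleftrightarrow> verts s \<inter> verts t \<in> ?A"
    if "lattice_adj s t" "s \<notin> {?f, ?g}" "t \<notin> {?f, ?g}" for s t
  proof -
    have "verts s \<inter> verts t \<notin> P" "verts s \<inter> verts t \<notin> Q"
      using P(2)[of "verts s \<inter> verts t"] Q(2)[of "verts s \<inter> verts t"] that(2,3)
        side_determines_squares[OF that(1), of ?f] side_determines_squares[OF that(1), of ?g] by auto
    then show ?thesis unfolding n[OF that(1)] by (auto simp: W_def)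
  qed
  have A_cut: "?A \<subseteq> edge_boundary filled" using range_nth_edge_v by blast
  have fg: "?f \<in> L" "?g \<in> L" "?f \<in> filled" "?g \<in> filled" using inner_in_L cluster_subset by blast+
  have ext: "\<not> n s" if "s \<notin> filled" for s
  proof (rule exterior_no_jump[of s "C \<union> L" n M])
    show "s \<in> exterior (C \<union> L)" using that by (simp add: filled_def)
    show "n s \<longleftrightarrow> n t" if "s \<in> exterior (C \<union> L)" "t \<in> exterior (C \<union> L)" "lattice_adj s t" for s t
      using jump[OF that(3)] side_in_edge_boundary[OF that(3), of filled] A_cut that fg by (auto simp: filled_def)
  qed (rule high)
  obtain c where c: "c \<in> C" using nonempty by blast
  have arc: "nth_edge v k \<in> ?A \<longleftrightarrow> k < q" if "p \<le> k" "k < p + m" for k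
  proof
    assume "nth_edge v k \<in> ?A"
    then obtain l where l: "p \<le> l" "l < q" "nth_edge v k = nth_edge v l" by auto
    then have "k mod m = l mod m" using nth_edge_eq_iff[OF cyclic_v] by blast
    then have "k = l" by (rule mod_eq_within_period) (use l that assms in auto)
    with l show "k < q" by simp
  qed (use that in auto)
  have at_inner: "n (inner k) \<longleftrightarrow> k < q" if "p \<le> k" "k < p + m" "inner k \<notin> {?f, ?g}" for k
  proof -
    obtain t where t: "lattice_adj (inner k) t" "t \<notin> filled" "nth_edge v k = verts (inner k) \<inter> verts t"
      using inner by metis
    then show ?thesis using jump[OF t(1) that(3)] arc[OF that(1,2)] ext[OF t(2)] fg by auto
  qed
  show ?thesis
  proof (cases "n c")
    case True
    have "inner k \<in> {?f, ?g} \<or> bridges ?f ?g (inner k)" if k: "k \<in> {q..<p + m}" for k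
    proof (cases "inner k \<in> {?f, ?g}")
      case False
      have "bridges ?f ?g (inner k)"
      proof (rule separated_square_bridges[of ?f ?g n c])
        show "n s \<longleftrightarrow> n t" if "lattice_adj s t" "s \<in> filled" "t \<in> filled" "s \<notin> {?f, ?g}" "t \<notin> {?f, ?g}" for s t
          using jump side_in_edge_boundary[of s t filled] A_cut that by blast
        show "\<not> n (inner k)" using at_inner[of k] k assms(1) False by auto
      qed (use fg c \<open>n c\<close> inner_in_L False in auto)
      then show ?thesis ..
    qed blast
    then show ?thesis by blast
  next
    case False
    (* Adding the whole boundary modulo 2 replaces the arc by the complementary one and the
       potential n by its exclusive or with membership in the filled cluster, which is the
       negation of n on that cluster. *)
    have "inner k \<in> {?f, ?g} \<or> bridges ?f ?g (inner k)" if k: "k \<in> {p..<q}" for k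
    proof (cases "inner k \<in> {?f, ?g}")
      case False
      have "bridges ?f ?g (inner k)"
      proof (rule separated_square_bridges[of ?f ?g "\<lambda>s. \<not> n s" c])
        show "\<not> n s \<longleftrightarrow> \<not> n t" if "lattice_adj s t" "s \<in> filled" "t \<in> filled" "s \<notin> {?f, ?g}" "t \<notin> {?f, ?g}" for s t
          using jump side_in_edge_boundary[of s t filled] A_cut that by blast
        show "\<not> \<not> n (inner k)" using at_inner[of k] k assms(2) False by auto
      qed (use fg c \<open>\<not> n c\<close> inner_in_L False in auto)
      then show ?thesis ..
    qed blast
    then show ?thesis by blast
  qed
qed

end

section \<open>Cyclic lists and their rotations\<close>

definition successive_pairs :: "'a list \<Rightarrow> 'a set set" where
  "successive_pairs xs = {{xs ! i, xs ! Suc i} | i. Suc i < length xs}"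

definition cyclic_pairs :: "'a list \<Rightarrow> 'a set set" where
  "cyclic_pairs xs = insert {last xs, hd xs} (successive_pairs xs)"

lemma successive_pairs_simps:
  "successive_pairs [] = {}" "successive_pairs [x] = {}"
  "successive_pairs (x # y # xs) = insert {x, y} (successive_pairs (y # xs))"
proof -
  show "successive_pairs (x # y # xs) = insert {x, y} (successive_pairs (y # xs))"
  proof (intro subset_antisym subsetI)
    fix e assume "e \<in> successive_pairs (x # y # xs)"
    then obtain i where i: "Suc i < length (x # y # xs)" "e = {(x # y # xs) ! i, (x # y # xs) ! Suc i}"
      unfolding successive_pairs_def by blast
    then show "e \<in> insert {x, y} (successive_pairs (y # xs))"
      by (cases i) (auto simp: successive_pairs_def)
  next
    fix e assume "e \<in> insert {x, y} (successive_pairs (y # xs))"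
    then consider "e = {x, y}" | i where "Suc i < length (y # xs)" "e = {(y # xs) ! i, (y # xs) ! Suc i}"
      unfolding successive_pairs_def by blast
    then show "e \<in> successive_pairs (x # y # xs)"
    proof cases
      case 1
      then have "Suc 0 < length (x # y # xs) \<and> e = {(x # y # xs) ! 0, (x # y # xs) ! Suc 0}" by simp
      then show ?thesis unfolding successive_pairs_def by blast
    next
      case (2 i)
      then have "Suc (Suc i) < length (x # y # xs) \<and>
          e = {(x # y # xs) ! Suc i, (x # y # xs) ! Suc (Suc i)}" by simp
      then show ?thesis unfolding successive_pairs_def by blast
    qed
  qed
qed (simp_all add: successive_pairs_def)

lemma successive_pairs_remdups_adj:
  "successive_pairs (remdups_adj xs) = {e \<in> successive_pairs xs. \<forall>x. e \<noteq> {x}}"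
proof (induction xs rule: remdups_adj.induct)
  case (3 x y xs)
  show ?case
  proof (cases "x = y")
    case True
    with 3 show ?thesis by (auto simp: successive_pairs_simps)
  next
    case False
    then have ne: "{x, y} \<noteq> {z}" for z by (metis doubleton_eq_iff insert_absorb2)
    have "remdups_adj (y # xs) = y # tl (remdups_adj (y # xs))"
      by (metis hd_remdups_adj list.collapse list.discI list.sel(1) remdups_adj_Nil_iff)
    then have "successive_pairs (remdups_adj (x # y # xs)) =
        insert {x, y} (successive_pairs (remdups_adj (y # xs)))"
      using False by (metis remdups_adj.simps(3) successive_pairs_simps(3))
    with 3(2)[OF False] ne show ?thesis by (auto simp: successive_pairs_simps)
  qed
qed (simp_all add: successive_pairs_simps)

lemma range_nth_edge_list:
  assumes "xs \<noteq> []"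
  shows "range (nth_edge (\<lambda>k. xs ! (k mod length xs))) = cyclic_pairs xs"
proof -
  let ?n = "length xs"
  have n: "?n > 0" using assms by simp
  have "nth_edge (\<lambda>k. xs ! (k mod ?n)) k \<in> cyclic_pairs xs" for k
  proof (cases "Suc (k mod ?n) = ?n")
    case True
    then have "k mod ?n = ?n - 1" "Suc k mod ?n = 0" by (simp_all add: mod_Suc)
    then show ?thesis using assms by (simp add: nth_edge_def cyclic_pairs_def last_conv_nth hd_conv_nth)
  next
    case False
    then have "Suc k mod ?n = Suc (k mod ?n)" by (simp add: mod_Suc)
    moreover have "Suc (k mod ?n) < ?n" using False n by (metis Suc_lessI mod_less_divisor)
    ultimately show ?thesis by (auto simp: nth_edge_def cyclic_pairs_def successive_pairs_def)
  qed
  moreover have "e \<in> range (nth_edge (\<lambda>k. xs ! (k mod ?n)))" if "e \<in> cyclic_pairs xs" for e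
  proof -
    from that consider "e = {last xs, hd xs}" | i where "Suc i < ?n" "e = {xs ! i, xs ! Suc i}"
      unfolding cyclic_pairs_def successive_pairs_def by blast
    then show ?thesis
    proof cases
      case 1
      have "nth_edge (\<lambda>k. xs ! (k mod ?n)) (?n - 1) = e"
        using 1 n assms by (simp add: nth_edge_def last_conv_nth hd_conv_nth)
      then show ?thesis by blast
    next
      case (2 i)
      then have "nth_edge (\<lambda>k. xs ! (k mod ?n)) i = e" by (simp add: nth_edge_def)
      then show ?thesis by blast
    qed
  qed
  ultimately show ?thesis by blast
qed

lemma cyclic_nth:
  assumes "distinct xs" "3 \<le> length xs"
  shows "cyclic (length xs) (\<lambda>k. xs ! (k mod length xs))"
  unfolding cyclic_def
proof (intro conjI allI)
  fix k l
  have "k mod length xs < length xs" "l mod length xs < length xs"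
    using assms(2) by (auto intro!: mod_less_divisor)
  then show "xs ! (k mod length xs) = xs ! (l mod length xs) \<longleftrightarrow> k mod length xs = l mod length xs"
    using assms(1) by (simp add: nth_eq_iff_index_eq)
qed (rule assms(2))

lemma range_nth:
  assumes "xs \<noteq> []"
  shows "range (\<lambda>k. xs ! (k mod length xs)) = set xs"
proof -
  have "xs ! (k mod length xs) \<in> set xs" for k using assms by simp
  moreover have "x \<in> range (\<lambda>k. xs ! (k mod length xs))" if x: "x \<in> set xs" for x
  proof -
    from x obtain i where "i < length xs" "xs ! i = x" by (auto simp: in_set_conv_nth)
    then have "x = xs ! (i mod length xs)" by simp
    then show ?thesis by blast
  qed
  ultimately show ?thesis by blast
qed

lemma cyclic_pairs_rev:
  assumes "xs \<noteq> []"
  shows "cyclic_pairs (rev xs) = cyclic_pairs xs"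
proof -
  have "successive_pairs (rev xs) \<subseteq> successive_pairs xs" for xs :: "'a list"
  proof
    fix e assume "e \<in> successive_pairs (rev xs)"
    then obtain i where i: "Suc i < length xs" "e = {rev xs ! i, rev xs ! Suc i}"
      unfolding successive_pairs_def by auto
    define j where "j = length xs - Suc (Suc i)"
    have "Suc j < length xs \<and> e = {xs ! j, xs ! Suc j}"
      using i by (auto simp: j_def rev_nth Suc_diff_Suc)
    then show "e \<in> successive_pairs xs" unfolding successive_pairs_def by blast
  qed
  from this[of xs] this[of "rev xs"] show ?thesis
    using assms by (auto simp: cyclic_pairs_def last_rev hd_rev insert_commute)
qed

text \<open>
  If equal entries always span a constant stretch, then merging stretches leaves distinct entries.
\<close>

lemma distinct_remdups_adj_if_contiguous:
  assumes "\<And>i j k. \<lbrakk>i < k; k < j; j < length xs; xs ! i = xs ! j\<rbrakk> \<Longrightarrow> xs ! k = xs ! i"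
  shows "distinct (remdups_adj xs)"
  using assms
proof (induction xs rule: remdups_adj.induct)
  case (3 x y xs)
  have tail: "(y # xs) ! k = (y # xs) ! i"
    if "i < k" "k < j" "j < length (y # xs)" "(y # xs) ! i = (y # xs) ! j" for i j k
    using 3(3)[of "Suc i" "Suc k" "Suc j"] that by simp
  show ?case
  proof (cases "x = y")
    case True
    then show ?thesis using 3(1) tail by simp
  next
    case False
    have "x \<notin> set (y # xs)"
    proof
      assume "x \<in> set (y # xs)"
      then obtain j where j: "j < length (y # xs)" "(y # xs) ! j = x" unfolding in_set_conv_nth by blast
      with False have "j \<noteq> 0" by (metis nth_Cons_0)
      then have "(x # y # xs) ! 1 = (x # y # xs) ! 0"
        using j by (intro 3(3)[of 0 1 "Suc j"]) auto
      with False show False by simp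
    qed
    with False show ?thesis using 3(2) tail by simp
  qed
qed simp_all

lemma cyclic_neighbours:
  assumes "cyclic n h" and f: "{u, f} \<in> range (nth_edge h)" and g: "{u, g} \<in> range (nth_edge h)"
    and x: "{u, x} \<in> range (nth_edge h)" and "f \<noteq> g"
  shows "x = f \<or> x = g"
proof -
  have neq: "h l \<noteq> h (Suc l)" for l
  proof
    assume "h l = h (Suc l)"
    then have "l mod n = Suc l mod n" using cyclic_eq[OF assms(1)] by blast
    then have "l = Suc l" by (rule mod_eq_within_period) (use assms(1) in \<open>auto simp: cyclic_def\<close>)
    then show False by simp
  qed
  obtain a where a: "u = h (Suc a)"
  proof -
    obtain l where "{u, f} = {h l, h (Suc l)}" using f by (auto simp: nth_edge_def)
    then have "u = h l \<or> u = h (Suc l)" by (metis insertCI insertE singletonD)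
    moreover have "h l = h (Suc (l + n - 1))"
      using assms(1) cyclic_eq[OF assms(1), of l "Suc (l + n - 1)"] by (simp add: cyclic_def)
    ultimately show thesis using that by metis
  qed
  have "y = h a \<or> y = h (Suc (Suc a))" if y: "{u, y} \<in> range (nth_edge h)" for y
  proof -
    obtain l where "{u, y} = {h l, h (Suc l)}" using y by (auto simp: nth_edge_def)
    then consider "u = h l" "y = h (Suc l)" | "u = h (Suc l)" "y = h l"
      by (auto simp: doubleton_eq_iff)
    then show ?thesis
    proof cases
      case 1
      then have "l mod n = Suc a mod n" using a cyclic_eq[OF assms(1)] by metis
      then have "Suc l mod n = Suc (Suc a) mod n" by (metis mod_Suc_eq)
      then show ?thesis using 1 cyclic_eq[OF assms(1)] by metis
    next
      case 2
      then have "h (l + 1) = h (a + 1)" using a by simp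
      then have "h l = h a"
        using cyclic_eq[OF cyclic_shift[OF assms(1), of 1]] cyclic_eq[OF assms(1)] by metis
      then show ?thesis using 2 by simp
    qed
  qed
  from this[OF f] this[OF g] this[OF x] \<open>f \<noteq> g\<close> show ?thesis by metis
qed

text \<open>
  A cyclic sequence with distinct entries that runs along the edges of another one cannot turn back,
  so its first step determines all others.
\<close>

lemma follows_same_direction:
  assumes h: "cyclic n h" and h': "cyclic n' h'" and sub: "range (nth_edge h') \<subseteq> range (nth_edge h)"
    and "h' 0 = h a" "h' 1 = h (Suc a)"
  shows "h' k = h (a + k)"
proof -
  have "h' k = h (a + k) \<and> h' (Suc k) = h (Suc (a + k))"
  proof (induction k)
    case 0
    show ?case using assms(4,5) by simp
  next
    case (Suc k)
    obtain l where l: "{h' (Suc k), h' (Suc (Suc k))} = {h l, h (Suc l)}"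
      using sub by (auto simp: nth_edge_def)
    have "h' (Suc (Suc k)) \<noteq> h' k"
    proof
      assume "h' (Suc (Suc k)) = h' k"
      then have "Suc (Suc k) mod n' = k mod n'" using cyclic_eq[OF h'] by blast
      then have "Suc (Suc k) = k"
        by (rule mod_eq_within_period) (use h' in \<open>auto simp: cyclic_def\<close>)
      then show False by simp
    qed
    from l consider "h' (Suc k) = h l" "h' (Suc (Suc k)) = h (Suc l)"
      | "h' (Suc k) = h (Suc l)" "h' (Suc (Suc k)) = h l"
      by (auto simp: doubleton_eq_iff)
    then show ?case
    proof cases
      case 1
      then have "l mod n = Suc (a + k) mod n" using Suc cyclic_eq[OF h] by metis
      then have "Suc l mod n = Suc (Suc (a + k)) mod n" by (metis mod_Suc_eq)
      then show ?thesis using 1 Suc cyclic_eq[OF h] by simp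
    next
      case 2
      then have "h (l + 1) = h (a + k + 1)" using Suc by simp
      then have "h l = h (a + k)"
        using cyclic_eq[OF cyclic_shift[OF h, of 1]] cyclic_eq[OF h] by metis
      then show ?thesis using 2 Suc \<open>h' (Suc (Suc k)) \<noteq> h' k\<close> by simp
    qed
  qed
  then show ?thesis ..
qed

lemma same_cycle_if_cyclic_pairs_subset:
  assumes "distinct xs" "distinct ys" "set ys = set xs" "3 \<le> length xs"
    and sub: "cyclic_pairs ys \<subseteq> cyclic_pairs xs"
  shows "\<exists>k. ys = rotate k xs \<or> ys = rotate k (rev xs)"
proof -
  have len: "length ys = length xs" using assms(1-3) by (metis distinct_card)
  have ne: "xs \<noteq> []" "ys \<noteq> []" using assms(4) len by auto
  let ?h = "\<lambda>zs k. zs ! (k mod length zs)"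
  have rotated: "ys = rotate a zs"
    if "length zs = length xs" "distinct zs" "cyclic_pairs ys \<subseteq> cyclic_pairs zs"
      "?h ys 0 = ?h zs a" "?h ys 1 = ?h zs (Suc a)" for zs a
  proof (rule nth_equalityI)
    show "length ys = length (rotate a zs)" using that len by simp
    fix k assume k: "k < length ys"
    have "zs \<noteq> []" using that(1) ne by auto
    have "?h ys k = ?h zs (a + k)"
    proof (rule follows_same_direction)
      show "cyclic (length zs) (?h zs)" "cyclic (length ys) (?h ys)"
        by (rule cyclic_nth; use that(1,2) assms(2,4) len in simp)+
      show "range (nth_edge (?h ys)) \<subseteq> range (nth_edge (?h zs))"
        using that(3) range_nth_edge_list[OF ne(2)] range_nth_edge_list[OF \<open>zs \<noteq> []\<close>] by simp
    qed (use that in auto)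
    then show "ys ! k = rotate a zs ! k" using k that(1) len by (simp add: nth_rotate)
  qed
  have "nth_edge (?h ys) 0 \<in> range (nth_edge (?h xs))"
    using sub range_nth_edge_list[OF ne(1)] range_nth_edge_list[OF ne(2)] by blast
  then obtain a where "{?h ys 0, ?h ys 1} = {?h xs a, ?h xs (Suc a)}" by (auto simp: nth_edge_def)
  then consider "?h ys 0 = ?h xs a" "?h ys 1 = ?h xs (Suc a)"
    | "?h ys 0 = ?h xs (Suc a)" "?h ys 1 = ?h xs a"
    by (metis doubleton_eq_iff)
  then show ?thesis
  proof cases
    case 1
    then show ?thesis using rotated[of xs a] assms(1) sub by blast
  next
    case 2
    let ?n = "length xs"
    (* the index in the reversed list of the entry of xs with index Suc a mod n *)
    define b where "b = ?n - 1 - Suc a mod ?n"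
    have n: "?n > 0" using ne by simp
    have rev: "?h (rev xs) k = ?h xs (?n - 1 - k mod ?n)" for k
      using n by (simp add: rev_nth)
    have b: "b < ?n" using n by (simp add: b_def)
    have "Suc a mod ?n \<le> ?n - 1" using n by (simp add: Suc_leI less_imp_le_nat mod_less_divisor le_diff_conv2 Suc_le_eq)
    then have b1: "?n - 1 - b = Suc a mod ?n" by (simp add: b_def)
    then have "?h (rev xs) b = ?h xs (Suc a)" using rev[of b] b by simp
    moreover have "?h (rev xs) (Suc b) = ?h xs a"
    proof (cases "Suc a mod ?n = 0")
      case True
      then have "Suc b = ?n" "a mod ?n = ?n - 1"
        using n by (auto simp: b_def mod_Suc split: if_splits)
      then show ?thesis using rev[of "Suc b"] n by simp
    next
      case False
      then have "Suc a mod ?n = Suc (a mod ?n)" by (auto simp: mod_Suc split: if_splits)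
      then have "Suc b < ?n" "?n - 1 - Suc b = a mod ?n" using b1 b by auto
      then show ?thesis using rev[of "Suc b"] by simp
    qed
    ultimately show ?thesis
      using 2 rotated[of "rev xs" b] assms(1) sub cyclic_pairs_rev[OF ne(1)] by auto
  qed
qed

section \<open>The cycle of boundary squares\<close>

context boundary_walk
begin

lemma boundary_square_iff:
  "s \<in> range inner \<longleftrightarrow> s \<in> filled \<and> (\<exists>t. lattice_adj s t \<and> t \<notin> filled)"
proof
  assume "s \<in> range inner"
  then show "s \<in> filled \<and> (\<exists>t. lattice_adj s t \<and> t \<notin> filled)" using inner by blast
next
  assume "s \<in> filled \<and> (\<exists>t. lattice_adj s t \<and> t \<notin> filled)"
  then obtain t where t: "s \<in> filled" "lattice_adj s t" "t \<notin> filled" by blast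
  then have "verts s \<inter> verts t \<in> range (nth_edge v)" using side_in_edge_boundary range_nth_edge_v by blast
  then obtain k where "nth_edge v k = verts s \<inter> verts t" by auto
  then have "s = inner k" using t(1) by (intro inner_unique) auto
  then show "s \<in> range inner" by blast
qed

text \<open>
  One boundary square on each of the four rays from a square of the component.
\<close>

lemma four_boundary_squares:
  obtains B where "B \<subseteq> range inner" "card B = 4"
proof -
  obtain c where c: "c \<in> C" using nonempty by blast
  have ray: "\<exists>k\<ge>1. (fst c + k * a, snd c + k * b) \<in> range inner" if "\<bar>a\<bar> + \<bar>b\<bar> = 1" for a b
    using ray_leaves_filled[OF c that] boundary_square_iff by metis
  obtain k1 where k1: "k1 \<ge> 1" "(fst c + k1 * 1, snd c + k1 * 0) \<in> range inner" using ray[of 1 0] by auto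
  obtain k2 where k2: "k2 \<ge> 1" "(fst c + k2 * - 1, snd c + k2 * 0) \<in> range inner" using ray[of "- 1" 0] by auto
  obtain k3 where k3: "k3 \<ge> 1" "(fst c + k3 * 0, snd c + k3 * 1) \<in> range inner" using ray[of 0 1] by auto
  obtain k4 where k4: "k4 \<ge> 1" "(fst c + k4 * 0, snd c + k4 * - 1) \<in> range inner" using ray[of 0 "- 1"] by auto
  show thesis
  proof (rule that)
    show "{(fst c + k1, snd c), (fst c - k2, snd c), (fst c, snd c + k3), (fst c, snd c - k4)} \<subseteq> range inner"
      using k1 k2 k3 k4 by simp
    show "card {(fst c + k1, snd c), (fst c - k2, snd c), (fst c, snd c + k3), (fst c, snd c - k4)} = 4"
      using k1(1) k2(1) k3(1) k4(1) by (simp add: card_insert_if)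
  qed
qed

text \<open>
  The case of a degenerate chord: a square never bridges a square with itself.
\<close>

lemma visits_contiguous:
  assumes "p < q" "q < p + m" "inner p = inner q"
  shows "(\<forall>k\<in>{p..<q}. inner k = inner p) \<or> (\<forall>k\<in>{q..<p + m}. inner k = inner p)"
  using chord_pins_one_arc[OF assms(1,2)] v_in_inner(1)[of p] assms(3) by (auto simp: bridges_def)

text \<open>
  The list arises from the inner squares of one turn around the boundary by merging repetitions. The
  turn has to start where the inner square changes, for otherwise the first and the last stretch
  could belong to the same square.
\<close>

lemma boundary_squares_list:
  obtains H where "distinct H" "set H = range inner" "4 \<le> length H"
    "cyclic_pairs H = {e \<in> range (nth_edge inner). \<forall>x. e \<noteq> {x}}"
proof -
  have m: "3 \<le> m" using cyclic_v by (simp add: cyclic_def)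
  obtain B where B: "B \<subseteq> range inner" "card B = 4" by (rule four_boundary_squares)
  have "\<exists>k. inner k \<noteq> inner (Suc k)"
  proof (rule ccontr)
    assume "\<not> ?thesis"
    then have "inner k = inner 0" for k by (induction k) auto
    then have "B \<subseteq> {inner 0}" using B(1) by auto
    then show False using B(2) card_mono[of "{inner 0}" B] by simp
  qed
  then obtain j where j: "inner j \<noteq> inner (Suc j)" by blast
  define s where "s k = inner (k + Suc j)" for k
  have periodic: "s k = s l" if "k mod m = l mod m" for k l
    unfolding s_def by (rule inner_periodic) (metis mod_add_left_eq that)
  have unshift: "inner k = s (k + (m - 1) * Suc j)" for k
  proof -
    have "k + (m - 1) * Suc j + Suc j = k + m * Suc j"
      using m by (cases m) simp_all
    then show ?thesis
      unfolding s_def by (intro inner_periodic) (simp only: mod_mult_self2)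
  qed
  have "s k \<in> range inner" "inner k \<in> range s" for k using unshift[of k] by (simp_all add: s_def)
  then have "range s \<subseteq> range inner" "range inner \<subseteq> range s" by blast+
  then have range_s: "range s = range inner" by (rule subset_antisym)
  have "nth_edge s k = nth_edge inner (k + Suc j)" for k by (simp add: nth_edge_def s_def)
  moreover have "nth_edge inner k = nth_edge s (k + (m - 1) * Suc j)" for k
    by (simp only: nth_edge_def unshift add_Suc)
  ultimately have "nth_edge s k \<in> range (nth_edge inner)" "nth_edge inner k \<in> range (nth_edge s)" for k by (metis rangeI)+
  then have "range (nth_edge s) \<subseteq> range (nth_edge inner)" "range (nth_edge inner) \<subseteq> range (nth_edge s)" by blast+
  then have range_nth_edge_s: "range (nth_edge s) = range (nth_edge inner)" by (rule subset_antisym)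
  define xs where "xs = map s [0..<m]"
  have xs: "length xs = m" "xs \<noteq> []" using m by (auto simp: xs_def)
  have nth: "(\<lambda>k. xs ! (k mod length xs)) = s"
  proof
    fix k
    have "k mod m < m" using m by simp
    then have "xs ! (k mod length xs) = s (k mod m)" by (simp add: xs_def)
    then show "xs ! (k mod length xs) = s k" using periodic[of "k mod m" k] by simp
  qed
  define H where "H = remdups_adj xs"
  have ends: "hd xs = s 0" "last xs = s (m - 1)" using m by (auto simp: xs_def hd_map last_map)
  have "s (m - 1) = inner j"
    unfolding s_def by (rule inner_periodic) (use m in simp)
  then have neq: "s (m - 1) \<noteq> s 0" using j by (simp add: s_def)
  have "distinct H"
    unfolding H_def
  proof (rule distinct_remdups_adj_if_contiguous)
    fix p k q assume *: "p < k" "k < q" "q < length xs" "xs ! p = xs ! q"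
    then have eq: "s p = s q" by (simp add: xs_def)
    have "(\<forall>l\<in>{p + Suc j..<q + Suc j}. inner l = s p) \<or> (\<forall>l\<in>{q + Suc j..<p + Suc j + m}. inner l = s p)"
      using visits_contiguous[of "p + Suc j" "q + Suc j"] * eq xs(1) by (simp add: s_def)
    then have "s k = s p"
    proof
      assume "\<forall>l\<in>{p + Suc j..<q + Suc j}. inner l = s p"
      moreover have "k + Suc j \<in> {p + Suc j..<q + Suc j}" using * by simp
      ultimately show ?thesis unfolding s_def[of k] by blast
    next
      assume around: "\<forall>l\<in>{q + Suc j..<p + Suc j + m}. inner l = s p"
      have "m - 1 + Suc j \<in> {q + Suc j..<p + Suc j + m}" using * xs(1) by auto
      with around have last: "s (m - 1) = s p" unfolding s_def[of "m - 1"] by blast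
      have "s 0 = s p"
      proof (cases "p = 0")
        case False
        then have "m + Suc j \<in> {q + Suc j..<p + Suc j + m}" using * xs(1) by auto
        with around have "s m = s p" unfolding s_def[of m] by blast
        then show ?thesis using periodic[of 0 m] by simp
      qed simp
      with last neq show ?thesis by simp
    qed
    then show "xs ! k = xs ! p" using * xs(1) by (simp add: xs_def)
  qed
  moreover have "set H = range inner"
    using range_nth[OF xs(2)] unfolding H_def nth range_s by simp
  moreover from this have "4 \<le> length H"
    using B card_mono[OF finite_set, of B H] distinct_card[OF \<open>distinct H\<close>] by simp
  moreover have "cyclic_pairs H = {e \<in> range (nth_edge inner). \<forall>x. e \<noteq> {x}}"
  proof -
    have "{last xs, hd xs} \<noteq> {x}" for x
      using neq ends by (metis doubleton_eq_iff insert_absorb2)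
    then have "cyclic_pairs H = {e \<in> cyclic_pairs xs. \<forall>x. e \<noteq> {x}}"
      by (auto simp: cyclic_pairs_def H_def successive_pairs_remdups_adj)
    then show ?thesis using range_nth_edge_list[OF xs(2)] by (simp add: nth range_nth_edge_s)
  qed
  ultimately show thesis by (rule that)
qed

lemma successive_or_bridged:
  assumes "f \<in> range inner" "g \<in> range inner" "f \<noteq> g" "verts f \<inter> verts g \<noteq> {}"
  obtains "{f, g} \<in> range (nth_edge inner)"
  | u where "bridges f g u" "{f, u} \<in> range (nth_edge inner)" "{u, g} \<in> range (nth_edge inner)"
proof -
  have m: "3 \<le> m" using cyclic_v by (simp add: cyclic_def)
  obtain p0 q0 where pq0: "f = inner p0" "g = inner q0" using assms(1,2) by blast
  define p where "p = p0 mod m"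
  define q where "q = (if p < q0 mod m then q0 mod m else q0 mod m + m)"
  have pq: "f = inner p" "g = inner q"
    unfolding pq0 by (rule inner_periodic; simp add: p_def q_def)+
  have lt: "p < m" "q0 mod m < m" using m by (simp_all add: p_def)
  then have "p < q" "q \<le> p + m"
    by (cases "p < q0 mod m"; simp only: q_def if_True if_False; linarith)+
  moreover have "q \<noteq> p + m" using pq assms(3) inner_periodic[of "p + m" p] by auto
  ultimately have range: "p < q" "q < p + m" by simp_all
  (* Along an arc from one of f, g to the other that meets nothing else but bridging squares,
     look at the step that leaves its starting square and the step that enters its last one:
     if neither joins f and g, both have the unique bridging square at their other end. *)
  have arc: "{f, g} \<in> range (nth_edge inner) \<or> (\<exists>u. bridges f g u \<and> {f, u} \<in> range (nth_edge inner) \<and> {u, g} \<in> range (nth_edge inner))"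
    if "a < b" and arc: "\<And>k. a \<le> k \<Longrightarrow> k < b \<Longrightarrow> inner k \<in> {f, g} \<or> bridges f g (inner k)"
      and ends: "inner a = f \<and> inner b = g \<or> inner a = g \<and> inner b = f" for a b
  proof -
    have not_bridge: "\<not> bridges f g f" "\<not> bridges f g g" by (auto simp: bridges_def lattice_adj_def)
    have leave: "\<exists>k. a \<le> k \<and> k < b \<and> inner k = inner a \<and> inner (Suc k) \<noteq> inner a"
    proof (rule ccontr)
      assume *: "\<not> ?thesis"
      have "inner k = inner a" if "a \<le> k" "k \<le> b" for k
        using that by (induction k rule: dec_induct) (use * in auto)
      from this[of b] ends assms(3) \<open>a < b\<close> show False by auto
    qed
    have enter: "\<exists>k. a \<le> k \<and> k < b \<and> inner k \<noteq> inner b \<and> inner (Suc k) = inner b"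
    proof (rule ccontr)
      assume *: "\<not> ?thesis"
      have "inner k \<noteq> inner b" if "a \<le> k" "k \<le> b" for k
        using that
      proof (induction k rule: dec_induct)
        case base
        show ?case using ends assms(3) by auto
      next
        case (step k)
        then have "a \<le> k" "k < b" "inner k \<noteq> inner b" by auto
        with * show ?case by blast
      qed
      from this[of b] \<open>a < b\<close> show False by simp
    qed
    obtain k where k: "a \<le> k" "k < b" "inner k = inner a" "inner (Suc k) \<noteq> inner a" using leave by blast
    obtain l where l: "a \<le> l" "l < b" "inner l \<noteq> inner b" "inner (Suc l) = inner b" using enter by blast
    have rng: "{inner k, inner (Suc k)} \<in> range (nth_edge inner)" for k unfolding nth_edge_def by blast
    show ?thesis
    proof (cases "inner (Suc k) = inner b \<or> inner l = inner a")
      case True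
      then show ?thesis using rng[of k] rng[of l] k(3) l(4) ends by (auto simp: insert_commute)
    next
      case False
      then have "Suc k < b" using k(2) by (metis Suc_lessI)
      then have u: "bridges f g (inner (Suc k))" using arc[of "Suc k"] k ends False by auto
      moreover have "bridges f g (inner l)" using arc[of l] l ends False by auto
      ultimately have "inner (Suc k) = inner l" using bridges_unique by blast
      then have "{inner a, inner l} \<in> range (nth_edge inner)" "{inner l, inner b} \<in> range (nth_edge inner)"
        using rng[of k] rng[of l] k(3) l(4) by simp_all
      with u \<open>inner (Suc k) = inner l\<close> ends
        insert_commute[of "inner l" "inner a" "{}"] insert_commute[of "inner l" "inner b" "{}"]
      show ?thesis by (elim disjE conjE) (rule disjI2, rule exI[of _ "inner l"], simp)+
    qed
  qed
  have "inner (p + m) = inner p" by (rule inner_periodic) simp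
  have "{f, g} \<in> range (nth_edge inner) \<or> (\<exists>u. bridges f g u \<and> {f, u} \<in> range (nth_edge inner) \<and> {u, g} \<in> range (nth_edge inner))"
    using chord_pins_one_arc[OF range, folded pq, OF assms(4)]
  proof
    assume "\<forall>k\<in>{p..<q}. inner k \<in> {f, g} \<or> bridges f g (inner k)"
    then show ?thesis by (intro arc[of p q]) (use range pq in auto)
  next
    assume "\<forall>k\<in>{q..<p + m}. inner k \<in> {f, g} \<or> bridges f g (inner k)"
    then show ?thesis by (intro arc[of q "p + m"]) (use range pq \<open>inner (p + m) = inner p\<close> in auto)
  qed
  with that show thesis by blast
qed

text \<open>
  Two overlapping bridges would make both end points of the common side of \<open>u\<close> and \<open>f\<close> centres of
  blocks of \<open>C \<union> L\<close>. But consecutive boundary squares share a vertex of the boundary, and such a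
  vertex is also a corner of an exterior square.
\<close>

lemma no_consecutive_bridges:
  assumes "bridges f g u" "bridges u h f" "{u, f} \<in> range (nth_edge inner)" "h \<in> L"
  shows False
proof -
  obtain c where c: "c \<in> C" "lattice_adj c f" "lattice_adj c g"
    and u: "u \<in> L" "f \<noteq> g" "lattice_adj u f" "lattice_adj u g"
    using assms(1) unfolding bridges_def by blast
  obtain c' where c': "c' \<in> C" "lattice_adj c' u" "lattice_adj c' h"
    and f: "f \<in> L" "u \<noteq> h" "lattice_adj f u" "lattice_adj f h"
    using assms(2) unfolding bridges_def by blast
  have g: "g \<in> C \<union> L" and h: "h \<in> C \<union> L" using neighbour c c' by blast+
  have neq: "u \<noteq> c" "f \<noteq> c'" using u(1) f(1) c(1) c'(1) disjoint by auto
  obtain x0 where x0: "\<And>t. x0 \<in> verts t \<longleftrightarrow> t \<in> {u, f, g, c}"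
    using block_vertex[OF u(3) c(2) u(4) c(3) u(2) neq(1)] by blast
  obtain x1 where x1: "\<And>t. x1 \<in> verts t \<longleftrightarrow> t \<in> {f, u, h, c'}"
    using block_vertex[OF f(3) c'(2) f(4) c'(3) f(2) neq(2)] by blast
  have "x0 \<noteq> x1"
  proof
    assume "x0 = x1"
    then have "c \<in> {f, u, h, c'}" using x0 x1 by blast
    then have "c = c'" using c(1) u(1) f(1) assms(4) disjoint by auto
    then show False using c(2) c'(2) u(3) lattice_adj_no_triangle by blast
  qed
  obtain k where k: "{inner k, inner (Suc k)} = {u, f}" using assms(3) by (auto simp: nth_edge_def)
  let ?x = "v (Suc k)"
  have "?x \<in> verts (inner k)" "?x \<in> verts (inner (Suc k))" using v_in_inner by blast+
  then have "?x \<in> verts u \<inter> verts f" using k by (metis IntI doubleton_eq_iff)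
  moreover have "x0 \<in> verts u \<inter> verts f" "x1 \<in> verts u \<inter> verts f" using x0 x1 by auto
  moreover obtain a b where "verts u \<inter> verts f = {a, b}" using u(3) side_unit_edge by metis
  ultimately have "?x = x0 \<or> ?x = x1" using \<open>x0 \<noteq> x1\<close> by auto
  moreover obtain t where "t \<notin> filled" "nth_edge v k = verts (inner k) \<inter> verts t" using inner by metis
  then have "t \<notin> filled" "?x \<in> verts t" by (auto simp: nth_edge_def)
  ultimately have "t \<in> {u, f, g, c, h, c'}" using x0 x1 by blast
  with \<open>t \<notin> filled\<close> show False using u(1) f(1) g h c(1) c'(1) cluster_subset by blast
qed

text \<open>
  If \<open>u\<close> touched a third boundary square, then this contact would be a chord too, and the square that
  bridges it would be \<open>f\<close> or \<open>g\<close>: two overlapping bridges.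
\<close>

lemma bridge_neighbours:
  assumes "bridges f g u" "{f, u} \<in> range (nth_edge inner)" "{u, g} \<in> range (nth_edge inner)"
    and h: "h \<in> range inner" "h \<noteq> u" "verts h \<inter> verts u \<noteq> {}"
  shows "h = f \<or> h = g"
proof -
  obtain H where H: "distinct H" "4 \<le> length H"
    "cyclic_pairs H = {e \<in> range (nth_edge inner). \<forall>x. e \<noteq> {x}}"
    by (rule boundary_squares_list)
  then have "H \<noteq> []" by auto
  define w where "w = (\<lambda>k. H ! (k mod length H))"
  have w: "cyclic (length H) w" unfolding w_def by (rule cyclic_nth) (use H in auto)
  have range_w: "{a, b} \<in> range (nth_edge w)" if "{a, b} \<in> range (nth_edge inner)" "a \<noteq> b" for a b
    unfolding w_def range_nth_edge_list[OF \<open>H \<noteq> []\<close>] H(3) using that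
    by (simp add: doubleton_eq_iff) (metis doubleton_eq_iff insert_absorb2)
  have b: "f \<noteq> g" "u \<noteq> f" "u \<noteq> g" using assms(1) by (auto simp: bridges_def lattice_adj_def)
  have uf: "{u, f} \<in> range (nth_edge inner)" using assms(2) by (simp add: insert_commute)
  have neighbours: "x = f \<or> x = g" if "{u, x} \<in> range (nth_edge inner)" "x \<noteq> u" for x
    by (rule cyclic_neighbours[OF w range_w[OF uf] range_w[OF assms(3)] range_w[OF that(1)]])
      (use b that in auto)
  have "u \<in> range inner"
  proof -
    obtain k where "{u, f} = {inner k, inner (Suc k)}" using uf by (auto simp: nth_edge_def)
    then show ?thesis by (metis insertCI insertE rangeI singletonD)
  qed
  then show ?thesis
  proof (rule successive_or_bridged[of u h])
    assume "{u, h} \<in> range (nth_edge inner)"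
    then show ?thesis using neighbours h(2) by blast
  next
    fix x assume x: "bridges u h x" "{u, x} \<in> range (nth_edge inner)"
    have "x \<noteq> u" using x(1) by (auto simp: bridges_def lattice_adj_def)
    moreover have "h \<in> L" using h(1) inner_in_L by blast
    ultimately show ?thesis
      using neighbours[OF x(2)] no_consecutive_bridges[OF assms(1), of h] assms(3) uf
        no_consecutive_bridges[of g f u h] assms(1) bridges_sym x(1) by blast
  qed (use h in auto)
qed

text \<open>
  Suppose that \<open>a\<close> and \<open>b\<close> are neighbours in \<open>H'\<close> but not in \<open>H\<close>. Then some \<open>u\<close> bridges them, and both
  neighbours of \<open>u\<close> in \<open>H'\<close> are among \<open>a\<close> and \<open>b\<close>. So \<open>a\<close>, \<open>u\<close>, \<open>b\<close> already form a closed triangle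
  in \<open>H'\<close>, which is impossible for at least four squares.
\<close>

lemma boundary_squares_cycle_unique:
  assumes H: "distinct H" "set H = range inner" "4 \<le> length H"
    "cyclic_pairs H = {e \<in> range (nth_edge inner). \<forall>x. e \<noteq> {x}}"
    and H': "distinct H'" "set H' = range inner"
    and touching: "\<And>a b. {a, b} \<in> cyclic_pairs H' \<Longrightarrow> verts a \<inter> verts b \<noteq> {}"
  shows "\<exists>k. H' = rotate k H \<or> H' = rotate k (rev H)"
proof (rule same_cycle_if_cyclic_pairs_subset)
  let ?n = "length H'"
  have n: "4 \<le> ?n" using H(1-3) H' by (metis distinct_card)
  then have ne: "H' \<noteq> []" by auto
  define w where "w = (\<lambda>k. H' ! (k mod ?n))"
  have w: "cyclic ?n w" unfolding w_def by (rule cyclic_nth) (use H' n in auto)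
  have range_nth_edge_w: "range (nth_edge w) = cyclic_pairs H'" unfolding w_def by (rule range_nth_edge_list[OF ne])
  have range_w: "range w = range inner" using range_nth[OF ne] H'(2) by (simp add: w_def)
  have neq: "w k \<noteq> w l" if "k < l" "l < k + ?n" for k l
  proof
    assume "w k = w l"
    then have "k mod ?n = l mod ?n" using cyclic_eq[OF w] by blast
    then have "k = l" by (rule mod_eq_within_period) (use that in auto)
    with that show False by simp
  qed
  have touch_w: "verts (w k) \<inter> verts (w (Suc k)) \<noteq> {}" for k
    using touching range_nth_edge_w unfolding nth_edge_def by blast
  show "cyclic_pairs H' \<subseteq> cyclic_pairs H"
  proof
    fix e assume "e \<in> cyclic_pairs H'"
    then obtain i where i: "e = {w i, w (Suc i)}" using range_nth_edge_w unfolding nth_edge_def by auto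
    have "w i \<noteq> w (Suc i)" using neq[of i "Suc i"] n by simp
    have "w i \<in> range inner" "w (Suc i) \<in> range inner" using range_w by blast+
    then show "e \<in> cyclic_pairs H"
      using \<open>w i \<noteq> w (Suc i)\<close> touch_w
    proof (rule successive_or_bridged)
      assume "{w i, w (Suc i)} \<in> range (nth_edge inner)"
      then show ?thesis unfolding H(4) i using \<open>w i \<noteq> w (Suc i)\<close>
        by (simp) (metis doubleton_eq_iff insert_absorb2)
    next
      fix u assume u: "bridges (w i) (w (Suc i)) u" "{w i, u} \<in> range (nth_edge inner)"
        "{u, w (Suc i)} \<in> range (nth_edge inner)"
      obtain k where "{w i, u} = {inner k, inner (Suc k)}" using u(2) by (auto simp: nth_edge_def)
      then have "u \<in> range w" unfolding range_w by (metis insertCI insertE rangeI singletonD)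
      then obtain j0 where "u = w j0" by blast
      define j where "j = j0 + ?n - 1"
      have j: "u = w (Suc j)"
        using \<open>u = w j0\<close> cyclic_eq[OF w, of j0 "Suc j"] ne by (simp add: j_def)
      have "w j = w i \<or> w j = w (Suc i)" "w (Suc (Suc j)) = w i \<or> w (Suc (Suc j)) = w (Suc i)"
        by (rule bridge_neighbours[OF u]; use range_w neq[of j "Suc j"] neq[of "Suc j" "Suc (Suc j)"]
            touch_w[of j] touch_w[of "Suc j"] n j in \<open>force simp: Int_commute\<close>)+
      moreover have "w j \<noteq> w (Suc (Suc j))" using neq[of j "Suc (Suc j)"] n by simp
      ultimately consider "w j = w i" | "w j = w (Suc i)" "w (Suc (Suc j)) = w i" by metis
      then show ?thesis
      proof cases
        case 1
        then have "j mod ?n = i mod ?n" using cyclic_eq[OF w] by blast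
        then have "w (Suc j) = w (Suc i)" using cyclic_eq[OF w] by (metis mod_Suc_eq)
        then show ?thesis using u(1) j by (auto simp: bridges_def lattice_adj_def)
      next
        case 2
        then have "Suc (Suc j) mod ?n = i mod ?n" using cyclic_eq[OF w] by blast
        then have "w (Suc (Suc (Suc j))) = w (Suc i)" using cyclic_eq[OF w] by (metis mod_Suc_eq)
        then show ?thesis using 2 neq[of j "Suc (Suc (Suc j))"] n by simp
      qed
    qed
  qed
qed (use H H' in auto)

end

section \<open>Grid edges as curves in the plane\<close>

definition pt :: "int \<times> int \<Rightarrow> complex" where
  "pt p = Complex (of_int (fst p) + 1/2) (of_int (snd p) + 1/2)"

lemma inj_pt: "inj pt"
  by (auto simp: inj_def pt_def)

lemma pt_image_eq_iff: "pt ` A = pt ` B \<longleftrightarrow> A = B"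
  by (rule inj_image_eq_iff[OF inj_pt])

lemma corners_eq: "corners s = pt ` verts s"
proof -
  obtain i j where s: "s = (i, j)" by (metis surj_pair)
  let ?P = "\<lambda>z. (Re z = of_int i - 1/2 \<or> Re z = of_int i + 1/2) \<and> (Im z = of_int j - 1/2 \<or> Im z = of_int j + 1/2)"
  have "z \<in> corners s \<longleftrightarrow> ?P z" for z
  proof
    assume "?P z"
    then show "z \<in> corners s" unfolding corners_def s
      by (intro CollectI exI[of _ "Re z - of_int i"] exI[of _ "Im z - of_int j"]) (auto simp: complex_eq_iff)
  qed (auto simp: corners_def s)
  moreover have "z \<in> pt ` verts s \<longleftrightarrow> ?P z" for z
  proof -
    have "pt ` verts s = {pt (i - 1, j - 1), pt (i - 1, j), pt (i, j - 1), pt (i, j)}"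
      unfolding verts_def s by auto
    then show ?thesis by (auto simp: pt_def complex_eq_iff)
  qed
  ultimately show ?thesis by blast
qed

lemma dist_pt_eq_1:
  assumes "p \<in> verts s" "q \<in> verts s"
  shows "dist (pt p) (pt q) = 1 \<longleftrightarrow> lattice_adj p q"
proof -
  obtain i j k l where pq: "p = (i, j)" "q = (k, l)" by (metis surj_pair)
  have "dist (pt p) (pt q) = sqrt ((of_int (i - k))\<^sup>2 + (of_int (j - l))\<^sup>2)"
    by (simp add: pq pt_def dist_complex_def cmod_def)
  moreover have "i - k \<in> {-1, 0, 1}" "j - l \<in> {-1, 0, 1}"
    using assms by (auto simp: pq verts_def)
  moreover have "sqrt ((of_int a)\<^sup>2 + (of_int b)\<^sup>2) = 1 \<longleftrightarrow> \<bar>a\<bar> + \<bar>b\<bar> = 1"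
    if "a \<in> {-1, 0, 1}" "b \<in> {-1, 0, 1}" for a b :: int
    using that by auto
  ultimately show ?thesis by (simp only: pq lattice_adj_def fst_conv snd_conv)
qed

lemma edges_of_eq: "edges_of s = {pt ` (verts s \<inter> verts t) | t. lattice_adj s t}"
proof (intro subset_antisym subsetI)
  fix e assume "e \<in> edges_of s"
  then obtain p q where pq: "p \<in> verts s" "q \<in> verts s" "dist (pt p) (pt q) = 1" "e = {pt p, pt q}"
    unfolding edges_of_def corners_eq by auto
  then have "lattice_adj p q" using dist_pt_eq_1 by blast
  then obtain t where "lattice_adj s t" "{p, q} = verts s \<inter> verts t"
    using unit_edge_side[of p q s] pq by blast
  moreover have "e = pt ` {p, q}" using pq(4) by simp
  ultimately have "lattice_adj s t \<and> e = pt ` (verts s \<inter> verts t)" by simp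
  then show "e \<in> {pt ` (verts s \<inter> verts t) | t. lattice_adj s t}" by blast
next
  fix e assume "e \<in> {pt ` (verts s \<inter> verts t) | t. lattice_adj s t}"
  then obtain t where t: "lattice_adj s t" "e = pt ` (verts s \<inter> verts t)" by blast
  then obtain p q where pq: "lattice_adj p q" "verts s \<inter> verts t = {p, q}" by (blast elim: side_unit_edge)
  then have "p \<in> verts s" "q \<in> verts s" by blast+
  with pq dist_pt_eq_1 have "dist (pt p) (pt q) = 1" by blast
  then show "e \<in> edges_of s"
    unfolding edges_of_def corners_eq t(2) pq(2) using \<open>p \<in> verts s\<close> \<open>q \<in> verts s\<close> by auto
qed

lemma star_adj_iff: "star_adj s t \<longleftrightarrow> s \<noteq> t \<and> verts s \<inter> verts t \<noteq> {}"
  unfolding star_adj_def corners_eq by (simp add: image_Int[OF inj_pt, symmetric])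

lemma plus_adj_iff: "plus_adj s t \<longleftrightarrow> lattice_adj s t"
proof
  assume "plus_adj s t"
  then obtain a b where "s \<noteq> t" "lattice_adj s a" "lattice_adj t b" "verts s \<inter> verts a = verts t \<inter> verts b"
    unfolding plus_adj_def edges_of_eq by (auto simp: pt_image_eq_iff)
  then show "lattice_adj s t" using side_inject by blast
next
  assume "lattice_adj s t"
  moreover from this have "lattice_adj t s" "s \<noteq> t"
    using lattice_adj_sym by (auto simp: lattice_adj_def)
  ultimately have "pt ` (verts s \<inter> verts t) \<in> edges_of s" "pt ` (verts s \<inter> verts t) \<in> edges_of t"
    unfolding edges_of_eq using Int_commute[of "verts s" "verts t"] by blast+
  with \<open>s \<noteq> t\<close> show "plus_adj s t" unfolding plus_adj_def by blast
qed

lemma square_region_iff: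
  "z \<in> square_region (i, j) \<longleftrightarrow> of_int i - 1/2 \<le> Re z \<and> Re z \<le> of_int i + 1/2 \<and>
     of_int j - 1/2 \<le> Im z \<and> Im z \<le> of_int j + 1/2"
  unfolding square_region_def by (auto simp: in_cbox_complex_iff)

lemma interior_square_region_iff:
  "z \<in> interior (square_region (i, j)) \<longleftrightarrow> of_int i - 1/2 < Re z \<and> Re z < of_int i + 1/2 \<and>
     of_int j - 1/2 < Im z \<and> Im z < of_int j + 1/2"
  unfolding square_region_def interior_cbox by (auto simp: in_box_complex_iff)

lemma hull_side:
  assumes "lattice_adj s t"
  shows "convex hull (pt ` (verts s \<inter> verts t)) = square_region s \<inter> square_region t"
proof -
  have right: "convex hull (pt ` (verts (i, j) \<inter> verts (i + 1, j))) = square_region (i, j) \<inter> square_region (i + 1, j)"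
    for i j
  proof -
    have "convex hull (pt ` (verts (i, j) \<inter> verts (i + 1, j))) = closed_segment (pt (i, j - 1)) (pt (i, j))"
      unfolding side_right by (simp add: segment_convex_hull)
    also have "\<dots> = {z. Re z = of_int i + 1/2 \<and> Im z \<in> {of_int j - 1/2..of_int j + 1/2}}"
      by (subst closed_segment_same_Re) (auto simp: pt_def closed_segment_eq_real_ivl)
    also have "\<dots> = square_region (i, j) \<inter> square_region (i + 1, j)"
      by (auto simp: square_region_iff)
    finally show ?thesis .
  qed
  have top: "convex hull (pt ` (verts (i, j) \<inter> verts (i, j + 1))) = square_region (i, j) \<inter> square_region (i, j + 1)"
    for i j
  proof -
    have "convex hull (pt ` (verts (i, j) \<inter> verts (i, j + 1))) = closed_segment (pt (i - 1, j)) (pt (i, j))"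
      unfolding side_top by (simp add: segment_convex_hull)
    also have "\<dots> = {z. Im z = of_int j + 1/2 \<and> Re z \<in> {of_int i - 1/2..of_int i + 1/2}}"
      by (subst closed_segment_same_Im) (auto simp: pt_def closed_segment_eq_real_ivl)
    also have "\<dots> = square_region (i, j) \<inter> square_region (i, j + 1)"
      by (auto simp: square_region_iff)
    finally show ?thesis .
  qed
  from assms show ?thesis
    by (rule lattice_adj_cases) (metis right top Int_commute)+
qed

text \<open>
  Coordinates of edges are half-integers, so that the strict inequalities that define open regions
  become inequalities between integers.
\<close>

lemma half_integers_apart:
  fixes a i :: int
  shows "real_of_int i - 1/2 < of_int a + 1/2 \<longleftrightarrow> i \<le> a"
    and "of_int a + 1/2 < real_of_int i + 1/2 \<longleftrightarrow> a < i"
  by linarith+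

lemma open_side_nonempty:
  assumes "lattice_adj s t"
  shows "convex hull (pt ` (verts s \<inter> verts t)) - pt ` (verts s \<inter> verts t) \<noteq> {}"
proof -
  obtain p q where pq: "lattice_adj p q" "verts s \<inter> verts t = {p, q}"
    using assms by (blast elim: side_unit_edge)
  then have "pt p \<noteq> pt q" using inj_pt by (auto simp: inj_eq lattice_adj_def)
  then have "midpoint (pt p) (pt q) \<notin> pt ` {p, q}" by (auto simp: midpoint_eq_endpoint)
  moreover have "midpoint (pt p) (pt q) \<in> convex hull (pt ` {p, q})"
    by (simp add: segment_convex_hull[symmetric])
  ultimately show ?thesis unfolding pq(2) by blast
qed

definition sides :: "complex set set" where
  "sides = {pt ` (verts s \<inter> verts t) | s t. lattice_adj s t}"

lemma sides_cases:
  assumes "e \<in> sides"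
  obtains i j where "e = pt ` (verts (i, j) \<inter> verts (i + 1, j))"
  | i j where "e = pt ` (verts (i, j) \<inter> verts (i, j + 1))"
proof -
  obtain s t where st: "lattice_adj s t" "e = pt ` (verts s \<inter> verts t)" using assms by (auto simp: sides_def)
  from st(1) show thesis by (rule lattice_adj_cases) (use st(2) that in \<open>simp add: Int_commute\<close>)+
qed

lemma curve_sides_cases:
  assumes "F \<subseteq> sides" "z \<in> curve F"
  obtains i j where "pt ` (verts (i, j) \<inter> verts (i + 1, j)) \<in> F"
      "Re z = of_int i + 1/2" "of_int j - 1/2 \<le> Im z" "Im z \<le> of_int j + 1/2"
  | i j where "pt ` (verts (i, j) \<inter> verts (i, j + 1)) \<in> F"
      "Im z = of_int j + 1/2" "of_int i - 1/2 \<le> Re z" "Re z \<le> of_int i + 1/2"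
proof -
  obtain e where e: "e \<in> F" "z \<in> convex hull e" using assms(2) by (auto simp: curve_def)
  have adj: "lattice_adj (i, j) (i + 1, j)" "lattice_adj (i, j) (i, j + 1)" for i j
    by (auto simp: lattice_adj_def)
  from e(1) assms(1) have "e \<in> sides" by blast
  then show thesis
  proof (rule sides_cases)
    fix i j assume "e = pt ` (verts (i, j) \<inter> verts (i + 1, j))"
    then show thesis using that(1)[of i j] e hull_side[OF adj(1)] by (auto simp: square_region_iff)
  next
    fix i j assume "e = pt ` (verts (i, j) \<inter> verts (i, j + 1))"
    then show thesis using that(2)[of i j] e hull_side[OF adj(2)] by (auto simp: square_region_iff)
  qed
qed

lemma interior_square_avoids_curve:
  assumes "F \<subseteq> sides"
  shows "interior (square_region s) \<inter> curve F = {}"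
proof (rule ccontr)
  assume "\<not> ?thesis"
  then obtain z where z: "z \<in> interior (square_region s)" "z \<in> curve F" by blast
  obtain i j where s: "s = (i, j)" by (metis surj_pair)
  from assms z(2) show False
    by (rule curve_sides_cases) (use z(1) half_integers_apart in \<open>auto simp: s interior_square_region_iff\<close>)
qed

text \<open>
  Two adjacent open squares with the open edge between them form an open rectangle. It meets no other
  edge of the grid, so one can pass from one square to the other inside it.
\<close>

lemma domino:
  assumes "lattice_adj s t" "F \<subseteq> sides" "pt ` (verts s \<inter> verts t) \<notin> F"
  obtains T where "connected T" "T \<inter> curve F = {}" "interior (square_region s) \<subseteq> T" "interior (square_region t) \<subseteq> T"
    "convex hull (pt ` (verts s \<inter> verts t)) - pt ` (verts s \<inter> verts t) \<subseteq> T"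
proof -
  define good where "good s t \<longleftrightarrow> (\<exists>T. connected T \<and> T \<inter> curve F = {} \<and>
    interior (square_region s) \<subseteq> T \<and> interior (square_region t) \<subseteq> T \<and>
    convex hull (pt ` (verts s \<inter> verts t)) - pt ` (verts s \<inter> verts t) \<subseteq> T)" for s t
  have sym: "good s t \<Longrightarrow> good t s" for s t unfolding good_def by (metis Int_commute)
  have right: "good (i, j) (i + 1, j)" if F: "pt ` (verts (i, j) \<inter> verts (i + 1, j)) \<notin> F" for i j
  proof -
    define T where "T = box (Complex (of_int i - 1/2) (of_int j - 1/2)) (Complex (of_int i + 3/2) (of_int j + 1/2))"
    have T: "z \<in> T \<longleftrightarrow> of_int i - 1/2 < Re z \<and> Re z < of_int (i + 1) + 1/2 \<and> of_int j - 1/2 < Im z \<and> Im z < of_int j + 1/2" for z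
      by (auto simp: T_def in_box_complex_iff)
    have "T \<inter> curve F = {}"
    proof (rule ccontr)
      assume "\<not> ?thesis"
      then obtain z where z: "z \<in> T" "z \<in> curve F" by blast
      from assms(2) z(2) show False
      proof (rule curve_sides_cases)
        fix a b assume ab: "pt ` (verts (a, b) \<inter> verts (a + 1, b)) \<in> F"
          "Re z = of_int a + 1/2" "of_int b - 1/2 \<le> Im z" "Im z \<le> of_int b + 1/2"
        then have "i \<le> a" "a < i + 1" using z(1) unfolding T by (simp_all only: half_integers_apart)
        moreover have "real_of_int j - 1/2 < of_int b + 1/2" "real_of_int b - 1/2 < of_int j + 1/2"
          using ab z(1) unfolding T by linarith+
        then have "j \<le> b" "b \<le> j" by (simp_all only: half_integers_apart)
        ultimately have "a = i" "b = j" by auto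
        with ab(1) F show False by simp
      next
        fix a b assume "Im z = of_int b + 1/2"
        then show False using z(1) half_integers_apart[of j b] half_integers_apart[of b j] unfolding T by auto
      qed
    qed
    moreover have "connected T" unfolding T_def by (intro convex_connected convex_box)
    moreover have "interior (square_region (i, j)) \<subseteq> T" "interior (square_region (i + 1, j)) \<subseteq> T"
      by (auto simp: T interior_square_region_iff)
    moreover have "convex hull (pt ` (verts (i, j) \<inter> verts (i + 1, j))) - pt ` (verts (i, j) \<inter> verts (i + 1, j)) \<subseteq> T"
    proof
      fix z assume z: "z \<in> convex hull (pt ` (verts (i, j) \<inter> verts (i + 1, j))) - pt ` (verts (i, j) \<inter> verts (i + 1, j))"
      have "lattice_adj (i, j) (i + 1, j)" by (simp add: lattice_adj_def)
      then have sq: "z \<in> square_region (i, j) \<inter> square_region (i + 1, j)" using z hull_side by blast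
      moreover have "z \<noteq> pt (i, j)" "z \<noteq> pt (i, j - 1)" using z unfolding side_right by auto
      ultimately have "Im z \<noteq> of_int j + 1/2" "Im z \<noteq> of_int j - 1/2"
        by (auto simp: pt_def complex_eq_iff square_region_iff)
      with sq show "z \<in> T" by (auto simp: T square_region_iff)
    qed
    ultimately show ?thesis unfolding good_def by blast
  qed
  have top: "good (i, j) (i, j + 1)" if F: "pt ` (verts (i, j) \<inter> verts (i, j + 1)) \<notin> F" for i j
  proof -
    define T where "T = box (Complex (of_int i - 1/2) (of_int j - 1/2)) (Complex (of_int i + 1/2) (of_int j + 3/2))"
    have T: "z \<in> T \<longleftrightarrow> of_int i - 1/2 < Re z \<and> Re z < of_int i + 1/2 \<and> of_int j - 1/2 < Im z \<and> Im z < of_int (j + 1) + 1/2" for z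
      by (auto simp: T_def in_box_complex_iff)
    have "T \<inter> curve F = {}"
    proof (rule ccontr)
      assume "\<not> ?thesis"
      then obtain z where z: "z \<in> T" "z \<in> curve F" by blast
      from assms(2) z(2) show False
      proof (rule curve_sides_cases)
        fix a b assume ab: "pt ` (verts (a, b) \<inter> verts (a, b + 1)) \<in> F"
          "Im z = of_int b + 1/2" "of_int a - 1/2 \<le> Re z" "Re z \<le> of_int a + 1/2"
        then have "j \<le> b" "b < j + 1" using z(1) unfolding T by (simp_all only: half_integers_apart)
        moreover have "real_of_int i - 1/2 < of_int a + 1/2" "real_of_int a - 1/2 < of_int i + 1/2"
          using ab z(1) unfolding T by linarith+
        then have "i \<le> a" "a \<le> i" by (simp_all only: half_integers_apart)
        ultimately have "a = i" "b = j" by auto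
        with ab(1) F show False by simp
      next
        fix a b assume "Re z = of_int a + 1/2"
        then show False using z(1) half_integers_apart[of i a] half_integers_apart[of a i] unfolding T by auto
      qed
    qed
    moreover have "connected T" unfolding T_def by (intro convex_connected convex_box)
    moreover have "interior (square_region (i, j)) \<subseteq> T" "interior (square_region (i, j + 1)) \<subseteq> T"
      by (auto simp: T interior_square_region_iff)
    moreover have "convex hull (pt ` (verts (i, j) \<inter> verts (i, j + 1))) - pt ` (verts (i, j) \<inter> verts (i, j + 1)) \<subseteq> T"
    proof
      fix z assume z: "z \<in> convex hull (pt ` (verts (i, j) \<inter> verts (i, j + 1))) - pt ` (verts (i, j) \<inter> verts (i, j + 1))"
      have "lattice_adj (i, j) (i, j + 1)" by (simp add: lattice_adj_def)
      then have sq: "z \<in> square_region (i, j) \<inter> square_region (i, j + 1)" using z hull_side by blast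
      moreover have "z \<noteq> pt (i, j)" "z \<noteq> pt (i - 1, j)" using z unfolding side_top by auto
      ultimately have "Re z \<noteq> of_int i + 1/2" "Re z \<noteq> of_int i - 1/2"
        by (auto simp: pt_def complex_eq_iff square_region_iff)
      with sq show "z \<in> T" by (auto simp: T square_region_iff)
    qed
    ultimately show ?thesis unfolding good_def by blast
  qed
  from assms(1) have "good s t"
    by (rule lattice_adj_cases) (use assms(3) right top sym in \<open>metis Int_commute\<close>)+
  with that show thesis unfolding good_def by blast
qed

lemma connected_subset_outside:
  assumes "connected T" "T \<inter> K = {}" "x \<in> T" "x \<in> outside K"
  shows "T \<subseteq> outside K"
proof
  fix y assume "y \<in> T"
  then have "connected_component (- K) x y"
    using assms(1-3) unfolding connected_component_def by blast
  with assms(4) show "y \<in> outside K" by (rule outside_same_component[rotated])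
qed

lemma connected_subset_inside:
  assumes "connected T" "T \<inter> K = {}" "x \<in> T" "x \<in> inside K"
  shows "T \<subseteq> inside K"
proof
  fix y assume "y \<in> T"
  then have "connected_component (- K) x y"
    using assms(1-3) unfolding connected_component_def by blast
  with assms(4) show "y \<in> inside K" by (rule inside_same_component[rotated])
qed

lemma square_region_nonempty: "interior (square_region s) \<noteq> {}"
proof -
  have "Complex (of_int (fst s)) (of_int (snd s)) \<in> interior (square_region (fst s, snd s))"
    unfolding interior_square_region_iff by simp
  then show ?thesis by auto
qed

text \<open>
  The upper half-plane above \<open>X\<close> is connected, unbounded and free of edges of \<open>F\<close>. An escape route
  leads there through edges that do not belong to \<open>F\<close>.
\<close>

lemma exterior_square_outside:
  assumes "s \<in> exterior X" "F \<subseteq> sides"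
    and avoid: "\<And>a b. a \<notin> X \<Longrightarrow> b \<notin> X \<Longrightarrow> lattice_adj a b \<Longrightarrow> pt ` (verts a \<inter> verts b) \<notin> F"
  shows "interior (square_region s) \<subseteq> outside (curve F)"
  using assms(1)
proof (induction rule: exterior_induct)
  case (above s)
  obtain i j where s: "s = (i, j)" by (metis surj_pair)
  let ?T = "{z. of_int j - 1/2 < Im z}"
  have "?T \<inter> curve F = {}"
  proof (rule ccontr)
    assume "\<not> ?thesis"
    then obtain z where z: "of_int j - 1/2 < Im z" "z \<in> curve F" by blast
    from assms(2) z(2) show False
    proof (rule curve_sides_cases)
      fix a b assume ab: "pt ` (verts (a, b) \<inter> verts (a + 1, b)) \<in> F" "Im z \<le> of_int b + 1/2"
      then have "real_of_int j - 1/2 < of_int b + 1/2" using z(1) by linarith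
      then have "j \<le> b" by (simp only: half_integers_apart)
      then show False using avoid[of "(a, b)" "(a + 1, b)"] above ab(1) by (simp add: s lattice_adj_def)
    next
      fix a b assume ab: "pt ` (verts (a, b) \<inter> verts (a, b + 1)) \<in> F" "Im z = of_int b + 1/2"
      then have "real_of_int j - 1/2 < of_int b + 1/2" using z(1) by linarith
      then have "j \<le> b" by (simp only: half_integers_apart)
      then show False using avoid[of "(a, b)" "(a, b + 1)"] above ab(1) by (simp add: s lattice_adj_def)
    qed
  qed
  moreover have "connected ?T"
    by (intro convex_connected convex_halfspace_Im_gt)
  moreover have "\<not> bounded ?T"
  proof
    assume "bounded ?T"
    then obtain B where B: "\<And>z. z \<in> ?T \<Longrightarrow> norm z \<le> B" unfolding bounded_iff by blast
    let ?z = "Complex 0 (\<bar>of_int j\<bar> + \<bar>B\<bar> + 1)"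
    have "?z \<in> ?T" by simp
    moreover have "\<bar>Im ?z\<bar> \<le> norm ?z" by (rule abs_Im_le_cmod)
    ultimately show False using B[of ?z] by simp
  qed
  ultimately have "?T \<subseteq> outside (curve F)"
  proof -
    assume T: "?T \<inter> curve F = {}" "connected ?T" "\<not> bounded ?T"
    have "x \<in> outside (curve F)" if "x \<in> ?T" for x
    proof -
      have "?T \<subseteq> connected_component_set (- curve F) x"
        using T(1,2) that by (intro connected_component_maximal) auto
      then have "\<not> bounded (connected_component_set (- curve F) x)" using T(3) bounded_subset by blast
      then show ?thesis using that T(1) unfolding outside_def by blast
    qed
    then show ?thesis by blast
  qed
  moreover have "interior (square_region s) \<subseteq> ?T" by (auto simp: s interior_square_region_iff)
  ultimately show ?case by blast
next
  case (step s t)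
  have "pt ` (verts s \<inter> verts t) \<notin> F" using avoid step exterior_disjoint by blast
  then obtain T where T: "connected T" "T \<inter> curve F = {}" "interior (square_region s) \<subseteq> T" "interior (square_region t) \<subseteq> T"
    using domino[OF step(3) assms(2)] by metis
  obtain x where x: "x \<in> interior (square_region t)" using square_region_nonempty by blast
  then have "T \<subseteq> outside (curve F)" using T step(4) connected_subset_outside[OF T(1,2), of x] by blast
  with T(3) show ?case by blast
qed

text \<open>
  Near a point \<open>z\<close> of the square \<open>s\<close> only the squares at distance at most two from \<open>s\<close> matter. So if
  \<open>z\<close> is on the frontier, it also belongs to one of the finitely many closed squares of the complement
  among them. If the two squares share only a corner, then one of their common neighbours provides a
  boundary edge through that corner.
\<close>

lemma square_regions_frontier:
  assumes "finite D"
  shows "frontier (\<Union>s\<in>D. square_region s) \<subseteq> curve ((`) pt ` edge_boundary D)"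
proof
  let ?K = "\<Union>s\<in>D. square_region s"
  fix z assume z: "z \<in> frontier ?K"
  have closed: "closed (square_region s)" for s unfolding square_region_def by (rule closed_cbox)
  then have "closed ?K" using assms by (intro closed_UN) auto
  with z have "z \<in> ?K" "z \<in> closure (- ?K)" by (auto simp: frontier_closures)
  then obtain s where s: "s \<in> D" "z \<in> square_region s" by blast
  obtain i j where ij: "s = (i, j)" by (metis surj_pair)
  define N where "N = {i - 2..i + 2} \<times> {j - 2..j + 2}"
  define B where "B = box (Complex (of_int i - 3/2) (of_int j - 3/2)) (Complex (of_int i + 3/2) (of_int j + 3/2))"
  define U where "U = (\<Union>t\<in>N - D. square_region t)"
  have "finite N" by (simp add: N_def)
  then have "closed U" unfolding U_def using closed by (intro closed_UN) auto
  have "z \<in> B" using s(2) by (auto simp: B_def ij square_region_iff in_box_complex_iff)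
  have "- ?K \<subseteq> U \<union> - B"
  proof
    fix y assume y: "y \<in> - ?K"
    define t where "t = (\<lfloor>Re y + 1/2\<rfloor>, \<lfloor>Im y + 1/2\<rfloor>)"
    have t: "y \<in> square_region t" unfolding t_def square_region_iff by linarith
    then have "t \<notin> D" using y by blast
    moreover have "t \<in> N" if "y \<in> B"
      using that unfolding B_def N_def t_def in_box_complex_iff by (simp, linarith)
    ultimately show "y \<in> U \<union> - B" using t unfolding U_def by blast
  qed
  moreover have "closed (U \<union> - B)" using \<open>closed U\<close> by (auto simp: B_def intro: closed_Un)
  ultimately have "closure (- ?K) \<subseteq> U \<union> - B" by (rule closure_minimal)
  with \<open>z \<in> closure (- ?K)\<close> \<open>z \<in> B\<close> obtain t where t: "t \<notin> D" "z \<in> square_region t" unfolding U_def by blast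
  have found: "z \<in> curve ((`) pt ` edge_boundary D)"
    if "lattice_adj a b" "a \<in> D" "b \<notin> D" "z \<in> square_region a" "z \<in> square_region b" for a b
  proof -
    have "z \<in> convex hull (pt ` (verts a \<inter> verts b))" using hull_side that by blast
    moreover have "verts a \<inter> verts b \<in> edge_boundary D" using side_in_edge_boundary that by blast
    ultimately show ?thesis unfolding curve_def by blast
  qed
  obtain k l where kl: "t = (k, l)" by (metis surj_pair)
  have "real_of_int i - 1/2 < of_int (k + 1) + 1/2" "real_of_int k - 1/2 < of_int (i + 1) + 1/2"
    "real_of_int j - 1/2 < of_int (l + 1) + 1/2" "real_of_int l - 1/2 < of_int (j + 1) + 1/2"
    using s(2) t(2) unfolding ij kl square_region_iff of_int_add of_int_1 by linarith+
  then have near: "\<bar>i - k\<bar> \<le> 1" "\<bar>j - l\<bar> \<le> 1" unfolding half_integers_apart by linarith+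
  show "z \<in> curve ((`) pt ` edge_boundary D)"
  proof (cases "lattice_adj s t")
    case True
    then show ?thesis using found s t by blast
  next
    case False
    moreover have "i \<noteq> k \<or> j \<noteq> l" using s(1) t(1) by (auto simp: ij kl)
    ultimately have "lattice_adj s (k, j)" "lattice_adj (k, j) t"
      using near unfolding ij kl lattice_adj_def fst_conv snd_conv by linarith+
    moreover have "z \<in> square_region (k, j)" using s(2) t(2) by (auto simp: ij kl square_region_iff)
    ultimately show ?thesis using found[of s "(k, j)"] found[of "(k, j)" t] s t by blast
  qed
qed

lemma edge_boundary_sides: "(`) pt ` edge_boundary D \<subseteq> sides"
  unfolding edge_boundary_def sides_def by blast

text \<open>
  A connected set that avoids the frontier of the union of the squares cannot leave the union, so its
  component is bounded.
\<close>

lemma square_regions_inside: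
  assumes "finite D"
  shows "(\<Union>s\<in>D. square_region s) - curve ((`) pt ` edge_boundary D) \<subseteq> inside (curve ((`) pt ` edge_boundary D))"
    (is "?K - ?c \<subseteq> _")
proof
  fix z assume z: "z \<in> ?K - ?c"
  let ?T = "connected_component_set (- ?c) z"
  have "bounded ?K"
    using assms by (intro bounded_UN ballI) (auto simp: square_region_def)
  moreover have "?T \<subseteq> ?K"
  proof (rule ccontr)
    assume "\<not> ?T \<subseteq> ?K"
    then have "?T - ?K \<noteq> {}" by blast
    moreover have "z \<in> ?T" using z by (simp add: connected_component_refl)
    then have "?T \<inter> ?K \<noteq> {}" using z by blast
    ultimately have "?T \<inter> frontier ?K \<noteq> {}"
      by (intro connected_Int_frontier connected_connected_component)
    moreover have "?T \<inter> ?c = {}" using connected_component_subset by blast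
    ultimately show False using square_regions_frontier[OF assms] by blast
  qed
  ultimately have "bounded ?T" by (rule bounded_subset)
  then show "z \<in> inside ?c" using z unfolding inside_def by blast
qed

lemma interior_inside:
  assumes "finite D" "s \<in> D"
  shows "interior (square_region s) \<subseteq> inside (curve ((`) pt ` edge_boundary D))"
proof -
  have "interior (square_region s) \<subseteq> square_region s" by (rule interior_subset)
  then show ?thesis
    using interior_square_avoids_curve[OF edge_boundary_sides, of s D] square_regions_inside[OF assms(1)] assms(2) by blast
qed

section \<open>The outermost boundary\<close>

lemma graph_edges_eq: "graph_edges A = {pt ` (verts s \<inter> verts t) | s t. s \<in> A \<and> lattice_adj s t}"
  unfolding graph_edges_def edges_of_eq by blast

lemma graph_edges_sides: "graph_edges A \<subseteq> sides"
  unfolding graph_edges_eq sides_def by blast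

lemma side_in_graph_edges:
  assumes "lattice_adj s t"
  shows "pt ` (verts s \<inter> verts t) \<in> graph_edges A \<longleftrightarrow> s \<in> A \<or> t \<in> A"
proof
  assume "pt ` (verts s \<inter> verts t) \<in> graph_edges A"
  then obtain a b where "a \<in> A" "lattice_adj a b" "verts s \<inter> verts t = verts a \<inter> verts b"
    unfolding graph_edges_eq by (auto simp: pt_image_eq_iff)
  then show "s \<in> A \<or> t \<in> A" using side_inject[OF assms] by blast
next
  assume "s \<in> A \<or> t \<in> A"
  then show "pt ` (verts s \<inter> verts t) \<in> graph_edges A"
    using assms lattice_adj_sym[of s t] Int_commute[of "verts s" "verts t"] unfolding graph_edges_eq by blast
qed

context enclosed_cluster
begin

text \<open>
  Escape routes never cross an edge of a square of the cluster.
\<close>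

lemma outside_graph_of_cluster:
  assumes "A \<subseteq> C \<union> L" "F \<subseteq> graph_edges A" "t \<notin> filled"
  shows "interior (square_region t) \<subseteq> outside (curve F)"
proof (rule exterior_square_outside)
  show "t \<in> exterior (C \<union> L)" using assms(3) by (simp add: filled_def)
  show "F \<subseteq> sides" using assms(2) graph_edges_sides by blast
  show "pt ` (verts a \<inter> verts b) \<notin> F" if "a \<notin> C \<union> L" "b \<notin> C \<union> L" "lattice_adj a b" for a b
    using side_in_graph_edges[OF that(3)] that assms by blast
qed

text \<open>
  An edge at an exterior square that is not part of \<open>F\<close> is open to the outside.
\<close>

lemma side_beyond_is_outside:
  assumes "A \<subseteq> C \<union> L" "F \<subseteq> graph_edges A" "t \<notin> filled" "lattice_adj s t" "pt ` (verts s \<inter> verts t) \<notin> F"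
  shows "interior (square_region s) \<subseteq> outside (curve F)"
    "convex hull (pt ` (verts s \<inter> verts t)) - pt ` (verts s \<inter> verts t) \<subseteq> outside (curve F)"
proof -
  have "F \<subseteq> sides" using assms(2) graph_edges_sides by blast
  then obtain T where T: "connected T" "T \<inter> curve F = {}" "interior (square_region s) \<subseteq> T"
    "interior (square_region t) \<subseteq> T"
    "convex hull (pt ` (verts s \<inter> verts t)) - pt ` (verts s \<inter> verts t) \<subseteq> T"
    using domino[OF assms(4) _ assms(5)] by metis
  obtain x where "x \<in> interior (square_region t)" using square_region_nonempty by blast
  then have "T \<subseteq> outside (curve F)"
    using T outside_graph_of_cluster[OF assms(1-3)] by (intro connected_subset_outside[of T _ x]) auto
  with T show "interior (square_region s) \<subseteq> outside (curve F)"
    "convex hull (pt ` (verts s \<inter> verts t)) - pt ` (verts s \<inter> verts t) \<subseteq> outside (curve F)"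
    by blast+
qed

end

context boundary_walk
begin

lemma edge_boundary_in_graph_edges:
  assumes "range inner \<subseteq> A"
  shows "(`) pt ` edge_boundary filled \<subseteq> graph_edges A"
proof
  fix e assume "e \<in> (`) pt ` edge_boundary filled"
  then obtain k where "e = pt ` nth_edge v k" unfolding range_nth_edge_v[symmetric] by blast
  moreover obtain t where "lattice_adj (inner k) t" "nth_edge v k = verts (inner k) \<inter> verts t" using inner by metis
  ultimately show "e \<in> graph_edges A" using side_in_graph_edges[of "inner k" t A] assms by auto
qed

lemma edge_boundary_graph_cycle:
  assumes "range inner \<subseteq> A"
  obtains vs where "graph_cycle A vs" "cycle_edges vs = (`) pt ` edge_boundary filled"
proof -
  define vs where "vs = map (pt \<circ> v) [0..<m]"
  have m: "3 \<le> m" using cyclic_v by (simp add: cyclic_def)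
  have edge: "{vs ! i, vs ! (Suc i mod length vs)} = pt ` nth_edge v i" if "i < m" for i
  proof -
    have "v (Suc i mod m) = v (Suc i)" using cyclic_eq[OF cyclic_v] by simp
    then show ?thesis using that m by (simp add: vs_def nth_edge_def)
  qed
  have "cycle_edges vs = (\<lambda>i. pt ` nth_edge v i) ` {0..<m}"
  proof -
    have "length vs = m" by (simp add: vs_def)
    then have "cycle_edges vs = {{vs ! i, vs ! (Suc i mod length vs)} | i. i < m}"
      unfolding cycle_edges_def by simp
    also have "\<dots> = (\<lambda>i. {vs ! i, vs ! (Suc i mod length vs)}) ` {0..<m}" by auto
    also have "\<dots> = (\<lambda>i. pt ` nth_edge v i) ` {0..<m}" by (rule image_cong) (use edge in auto)
    finally show ?thesis .
  qed
  also have "\<dots> = (`) pt ` nth_edge v ` {0..<0 + m}" by (simp add: image_image)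
  also have "\<dots> = (`) pt ` edge_boundary filled"
    using range_nth_edge_period[OF cyclic_v, of 0] range_nth_edge_v by simp
  finally have edges: "cycle_edges vs = (`) pt ` edge_boundary filled" .
  have "inj_on v {0..<m}" using cyclic_eq[OF cyclic_v] by (auto simp: inj_on_def)
  then have "distinct vs"
    unfolding vs_def by (simp add: distinct_map comp_inj_on inj_on_subset[OF inj_pt])
  with edges m edge_boundary_in_graph_edges[OF assms] have "graph_cycle A vs"
    unfolding graph_cycle_def by (simp add: vs_def)
  with edges show thesis using that by blast
qed

text \<open>
  An edge of \<open>A\<close> that is not a boundary edge is an edge of a filled square and so lies in the interior
  of the boundary, which is itself a cycle in the graph of \<open>A\<close>. A boundary edge, on the other hand, has an
  exterior square on its other side, and this square is outside every cycle of the graph.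
\<close>

lemma outermost_boundary_eq:
  assumes "range inner \<subseteq> A" "A \<subseteq> C \<union> L"
  shows "outermost_boundary A = (`) pt ` edge_boundary filled"
proof (intro subset_antisym subsetI)
  fix e assume e: "e \<in> outermost_boundary A"
  show "e \<in> (`) pt ` edge_boundary filled"
  proof (rule ccontr)
    assume no: "e \<notin> (`) pt ` edge_boundary filled"
    obtain s t where st: "s \<in> A" "lattice_adj s t" "e = pt ` (verts s \<inter> verts t)"
      using e unfolding outermost_boundary_def graph_edges_eq by blast
    obtain vs where "graph_cycle A vs" "cycle_edges vs = (`) pt ` edge_boundary filled"
      using edge_boundary_graph_cycle[OF assms(1)] .
    with e no have out: "convex hull e - e \<subseteq> outside (curve ((`) pt ` edge_boundary filled))"
      unfolding outermost_boundary_def by force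
    obtain T where T: "connected T" "T \<inter> curve ((`) pt ` edge_boundary filled) = {}"
      "interior (square_region s) \<subseteq> T" "convex hull e - e \<subseteq> T"
      using domino[OF st(2) edge_boundary_sides[of filled]] no unfolding st(3) by metis
    obtain x where "x \<in> interior (square_region s)" using square_region_nonempty by blast
    moreover have "s \<in> filled" using st(1) assms(2) cluster_subset by blast
    ultimately have "T \<subseteq> inside (curve ((`) pt ` edge_boundary filled))"
      using T interior_inside[OF finite_filled, of s] by (intro connected_subset_inside[of T _ x]) auto
    with out T(4) have "convex hull e - e \<subseteq> {}" using inside_Int_outside by blast
    with open_side_nonempty[OF st(2)] st(3) show False by blast
  qed
next
  fix e assume e: "e \<in> (`) pt ` edge_boundary filled"
  then obtain s t where st: "lattice_adj s t" "s \<in> filled" "t \<notin> filled" "e = pt ` (verts s \<inter> verts t)"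
    unfolding edge_boundary_def by auto
  have "convex hull e - e \<subseteq> outside (curve (cycle_edges vs))"
    if "graph_cycle A vs" "e \<notin> cycle_edges vs" for vs
  proof -
    have "cycle_edges vs \<subseteq> graph_edges A" using that(1) by (simp add: graph_cycle_def)
    with side_beyond_is_outside(2)[OF assms(2) _ st(3,1)] that(2) st(4) show ?thesis by blast
  qed
  with e edge_boundary_in_graph_edges[OF assms(1)] show "e \<in> outermost_boundary A"
    unfolding outermost_boundary_def by blast
qed

text \<open>
  If the square \<open>s\<close> were missing from \<open>A\<close>, its boundary edge would be missing from the graph of \<open>A\<close>, and \<open>s\<close>
  would be joined to the outside through it.
\<close>

lemma boundary_square_in_surrounding:
  assumes "A \<subseteq> C \<union> L" "F \<subseteq> graph_edges A" "s \<in> range inner"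
    and "s \<in> A \<or> interior (square_region s) \<subseteq> inside (curve F)"
  shows "s \<in> A"
proof (rule ccontr)
  assume "s \<notin> A"
  obtain t where t: "lattice_adj s t" "t \<notin> filled" using assms(3) boundary_square_iff by blast
  then have "t \<notin> A" using assms(1) cluster_subset by blast
  then have "pt ` (verts s \<inter> verts t) \<notin> F"
    using side_in_graph_edges[OF t(1)] \<open>s \<notin> A\<close> assms(2) by blast
  then have "interior (square_region s) \<subseteq> outside (curve F)"
    using side_beyond_is_outside(1) assms(1,2) t by blast
  with assms(4) \<open>s \<notin> A\<close> have "interior (square_region s) \<subseteq> {}" using inside_Int_outside by blast
  with square_region_nonempty show False by blast
qed

end

section \<open>The surrounding cycle of the occupied component\<close>

text \<open>
  Every prefix of a path from the origin is itself such a path.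
\<close>

lemma plus_component_path:
  assumes "p \<noteq> []" "hd p = (0, 0)" "distinct p" "set p \<subseteq> occ" "successively plus_adj p"
  shows "set p \<subseteq> plus_component occ"
proof
  fix x assume "x \<in> set p"
  then obtain ys zs where p: "p = (ys @ [x]) @ zs" by (metis append.assoc append_Cons append_Nil split_list)
  have "hd (ys @ [x]) = (0, 0)" using assms(2) unfolding p by (cases ys) auto
  moreover have "successively plus_adj (ys @ [x])" using assms(5) unfolding p successively_append_iff by blast
  ultimately show "x \<in> plus_component occ"
    unfolding plus_component_def using assms(3,4) p by (intro CollectI exI[of _ "ys @ [x]"]) auto
qed

lemma plus_component_step:
  assumes "s \<in> plus_component occ" "lattice_adj s t" "t \<in> occ"
  shows "t \<in> plus_component occ"
proof -
  obtain p where p: "p \<noteq> []" "hd p = (0, 0)" "last p = s" "distinct p" "set p \<subseteq> occ" "successively plus_adj p"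
    using assms(1) unfolding plus_component_def by blast
  show ?thesis
  proof (cases "t \<in> set p")
    case True
    then show ?thesis using plus_component_path p by blast
  next
    case False
    have "successively plus_adj (p @ [t])"
      using p assms(2) by (auto simp: successively_append_iff plus_adj_iff)
    then show ?thesis
      unfolding plus_component_def using p assms(3) False by (intro CollectI exI[of _ "p @ [t]"]) auto
  qed
qed

lemma enclosed_cluster_plus_component:
  assumes "(0, 0) \<in> occ" "finite (plus_component occ)"
  shows "enclosed_cluster (plus_component occ) (vacant_boundary occ)"
proof
  have occ: "plus_component occ \<subseteq> occ" unfolding plus_component_def by (auto dest: last_in_set)
  have origin: "(0, 0) \<in> plus_component occ"
    using assms(1) unfolding plus_component_def by (intro CollectI exI[of _ "[(0, 0)]"]) simp
  then show "plus_component occ \<noteq> {}" by blast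
  show "finite (plus_component occ)" by (rule assms(2))
  show "plus_component occ \<inter> vacant_boundary occ = {}" using occ unfolding vacant_boundary_def by blast
  show "t \<in> plus_component occ \<union> vacant_boundary occ" if st: "s \<in> plus_component occ" "lattice_adj s t" for s t
  proof (cases "t \<in> occ")
    case False
    obtain p q where "verts s \<inter> verts t = {p, q}" using st(2) by (blast elim: side_unit_edge)
    then have "corners t \<inter> corners s \<noteq> {}" unfolding corners_eq by blast
    with False st(1) show ?thesis unfolding vacant_boundary_def by blast
  qed (use plus_component_step st in blast)
  show "\<exists>s\<in>plus_component occ. verts s \<inter> verts t \<noteq> {}" if "t \<in> vacant_boundary occ" for t
    using that unfolding vacant_boundary_def corners_eq image_Int[OF inj_pt, symmetric] by blast
  show "A = plus_component occ"
    if sub: "A \<subseteq> plus_component occ" and ne: "A \<noteq> {}"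
      and closed: "\<And>s t. s \<in> A \<Longrightarrow> t \<in> plus_component occ \<Longrightarrow> lattice_adj s t \<Longrightarrow> t \<in> A" for A
  proof -
    have along: "\<forall>x\<in>set p. x \<in> A \<longleftrightarrow> hd p \<in> A"
      if "set p \<subseteq> plus_component occ" "successively plus_adj p" for p
      using that
    proof (induction p rule: induct_list012)
      case (3 x y zs)
      then have "lattice_adj x y" "x \<in> plus_component occ" "y \<in> plus_component occ"
        by (simp_all add: plus_adj_iff)
      then have "x \<in> A \<longleftrightarrow> y \<in> A" using closed lattice_adj_sym[of x y] by blast
      with 3 show ?case by simp
    qed simp_all
    have "s \<in> A \<longleftrightarrow> (0, 0) \<in> A" if s: "s \<in> plus_component occ" for s
    proof -
      obtain p where p: "p \<noteq> []" "hd p = (0, 0)" "last p = s" "distinct p" "set p \<subseteq> occ" "successively plus_adj p"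
        using s unfolding plus_component_def by blast
      then show ?thesis using along[OF plus_component_path] last_in_set by metis
    qed
    with sub ne show ?thesis by blast
  qed
qed

lemma star_S_cycle_iff_cyclic_pairs:
  "star_S_cycle H \<longleftrightarrow> H \<noteq> [] \<and> (\<forall>a b. {a, b} \<in> cyclic_pairs H \<longrightarrow> star_adj a b)"
proof -
  have sym: "star_adj a b \<longleftrightarrow> star_adj b a" for a b unfolding star_adj_def by blast
  have pair: "(\<forall>a b. {a, b} = {x, y} \<longrightarrow> star_adj a b) \<longleftrightarrow> star_adj x y" for x y
    using sym[of x y] by (metis doubleton_eq_iff)
  have "(\<forall>a b. {a, b} \<in> cyclic_pairs H \<longrightarrow> star_adj a b) \<longleftrightarrow>
      (\<forall>a b. {a, b} = {last H, hd H} \<longrightarrow> star_adj a b) \<and>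
      (\<forall>i. Suc i < length H \<longrightarrow> (\<forall>a b. {a, b} = {H ! i, H ! Suc i} \<longrightarrow> star_adj a b))"
    unfolding cyclic_pairs_def successive_pairs_def by blast
  then show ?thesis
    unfolding star_S_cycle_def star_S_path_def successively_conv_nth pair by blast
qed

theorem theorem2:
  fixes occ :: "square set"
  assumes "(0, 0) \<in> occ"
    and "finite (plus_component occ)"
  shows "\<exists>H. surrounding_S_cycle occ H \<and> distinct H \<and>
           (\<forall>H'. surrounding_S_cycle occ H' \<longrightarrow>
              outermost_boundary (set H') = outermost_boundary (set H) \<and>
              set H \<subseteq> set H' \<and>
              (length H' \<le> length H \<longrightarrow> same_S_cycle H H'))"
proof -
  interpret enclosed_cluster "plus_component occ" "vacant_boundary occ"
    using assms by (rule enclosed_cluster_plus_component)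
  obtain m v where "cyclic m v" "range (nth_edge v) = edge_boundary filled" by (rule boundary_is_cycle)
  then interpret boundary_walk "plus_component occ" "vacant_boundary occ" m v
    by unfold_locales
  obtain H where H: "distinct H" "set H = range inner" "4 \<le> length H"
    "cyclic_pairs H = {e \<in> range (nth_edge inner). \<forall>x. e \<noteq> {x}}"
    by (rule boundary_squares_list)
  have star: "star_S_cycle H"
    unfolding star_S_cycle_iff_cyclic_pairs
  proof (intro conjI allI impI)
    show "H \<noteq> []" using H(3) by auto
    fix a b assume "{a, b} \<in> cyclic_pairs H"
    then obtain k where k: "{a, b} = {inner k, inner (Suc k)}" and "a \<noteq> b"
      unfolding H(4) nth_edge_def by fastforce
    have "verts (inner k) \<inter> verts (inner (Suc k)) \<noteq> {}" using v_in_inner(2)[of k] v_in_inner(1)[of "Suc k"] by blast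
    then have "verts a \<inter> verts b \<noteq> {}" using k by (metis Int_commute doubleton_eq_iff)
    with \<open>a \<noteq> b\<close> show "star_adj a b" by (simp add: star_adj_iff)
  qed
  have H_L: "set H \<subseteq> vacant_boundary occ" using H(2) inner_in_L by auto
  have boundary: "outermost_boundary A = (`) pt ` edge_boundary filled"
    if "set H \<subseteq> A" "A \<subseteq> vacant_boundary occ" for A
    by (rule outermost_boundary_eq) (use that H(2) in auto)
  have "single_cycle (set H) (outermost_boundary (set H))"
    unfolding single_cycle_def boundary[OF subset_refl H_L]
    using edge_boundary_graph_cycle[of "set H"] H(2) by (metis subset_refl)
  moreover have "s \<in> set H \<or> interior (square_region s) \<subseteq> inside (curve (outermost_boundary (set H)))"
    if "s \<in> plus_component occ \<union> vacant_boundary occ" for s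
    unfolding boundary[OF subset_refl H_L] using interior_inside[OF finite_filled] that cluster_subset by blast
  ultimately have "surrounding_S_cycle occ H"
    unfolding surrounding_S_cycle_def using star H_L by blast
  moreover have "outermost_boundary (set H') = outermost_boundary (set H) \<and> set H \<subseteq> set H' \<and>
      (length H' \<le> length H \<longrightarrow> same_S_cycle H H')"
    if H': "surrounding_S_cycle occ H'" for H'
  proof (intro conjI impI)
    have star': "star_S_cycle H'" and H'_L: "set H' \<subseteq> vacant_boundary occ"
      and inside: "\<And>s. s \<in> plus_component occ \<union> vacant_boundary occ \<Longrightarrow>
        s \<in> set H' \<or> interior (square_region s) \<subseteq> inside (curve (outermost_boundary (set H')))"
      using H' unfolding surrounding_S_cycle_def by blast+
    have "s \<in> set H'" if "s \<in> set H" for s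
    proof (rule boundary_square_in_surrounding)
      show "set H' \<subseteq> plus_component occ \<union> vacant_boundary occ" using H'_L by blast
      show "outermost_boundary (set H') \<subseteq> graph_edges (set H')" unfolding outermost_boundary_def by blast
      show "s \<in> range inner" using that H(2) by simp
      show "s \<in> set H' \<or> interior (square_region s) \<subseteq> inside (curve (outermost_boundary (set H')))"
        by (rule inside) (use that H_L in blast)
    qed
    then show sub: "set H \<subseteq> set H'" by blast
    show "outermost_boundary (set H') = outermost_boundary (set H)"
      using boundary[OF sub H'_L] boundary[OF subset_refl H_L] by simp
    assume "length H' \<le> length H"
    moreover have "length H \<le> card (set H')"
      using card_mono[OF finite_set sub] distinct_card[OF H(1)] by simp
    moreover have "card (set H') \<le> length H'" by (rule card_length)
    ultimately have card: "card (set H') = length H'" "card (set H') = card (set H)"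
      using distinct_card[OF H(1)] by simp_all
    then have "distinct H'" "set H' = set H"
      using card_distinct card_subset_eq[OF finite_set sub] by auto
    moreover have "verts a \<inter> verts b \<noteq> {}" if "{a, b} \<in> cyclic_pairs H'" for a b
      using star' that unfolding star_S_cycle_iff_cyclic_pairs star_adj_iff by blast
    ultimately show "same_S_cycle H H'"
      unfolding same_S_cycle_def using boundary_squares_cycle_unique[OF H] H(2) by simp
  qed
  ultimately show ?thesis using H(1) by blast
qed

end
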